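(* Let $f,g\in L^2(\mathbb{R}^{2d},\mathbb{H})$ with $f\neq0$ and $g\neq0$. Then $$E\big(|A(f,g)|^2\big)\ge\|f\|_{2,2d}^2\|g\|_{2,2d}^2\Big(2d\ln2-\ln\big(\|f\|_{2,2d}^2\|g\|_{2,2d}^2\big)\Big).$$
   Context: $d\ge 1$ is an integer and $\mathbb{H}$ is the algebra of quaternions with units $i,j,k$. On $\mathbb{R}^n$, $d\mu_n(x)=dx/(2\pi)^{n/2}$, $\|f\|_{2,n}=\big(\int_{\mathbb{R}^n}|f|^2d\mu_n\big)^{1/2}$, and $\mathbb{R}^{2d}\times\mathbb{R}^{2d}$ is identified with $\mathbb{R}^{4d}$. The radar quaternion ambiguity function is $$A(f,g)(x,w)=\int_{\mathbb{R}^{2d}}e^{-i\,t_1\cdot w_1}f\big(t+\tfrac x2\big)\overline{g\big(t-\tfrac x2\big)}e^{-j\,t_2\cdot w_2}\,d\mu_{2d}(t),\quad x\in\mathbb{R}^{2d},\ w=(w_1,w_2),\ t=(t_1,t_2)\in\mathbb{R}^d\times\mathbb{R}^d.$$ The entropy of a non-negative integrable function $P$ on $\mathbb{R}^{2d}\times\mathbb{R}^{2d}$ is $E(P)=-\iint_{\mathbb{R}^{2d}\times\mathbb{R}^{2d}}\ln(P(x,w))\,P(x,w)\,d\mu_{4d}(x,w)$ (with $0\ln0=0$), which is allowed to be $+\infty$. *)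

theory Defs
  imports "HOL-Analysis.Analysis"
begin

section \<open>The quaternions as a real normed algebra\<close>

codatatype quat = Quat (qRe: real) (qIm1: real) (qIm2: real) (qIm3: real)

lemma quat_eq_iff:
  "x = y \<longleftrightarrow> qRe x = qRe y \<and> qIm1 x = qIm1 y \<and> qIm2 x = qIm2 y \<and> qIm3 x = qIm3 y"
  by (auto intro: quat.expand)

instantiation quat :: ab_group_add
begin

primcorec zero_quat where
  "qRe 0 = 0" | "qIm1 0 = 0" | "qIm2 0 = 0" | "qIm3 0 = 0"

primcorec plus_quat where
  "qRe (x + y) = qRe x + qRe y"
| "qIm1 (x + y) = qIm1 x + qIm1 y"
| "qIm2 (x + y) = qIm2 x + qIm2 y"
| "qIm3 (x + y) = qIm3 x + qIm3 y"

primcorec uminus_quat where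
  "qRe (- x) = - qRe x"
| "qIm1 (- x) = - qIm1 x"
| "qIm2 (- x) = - qIm2 x"
| "qIm3 (- x) = - qIm3 x"

primcorec minus_quat where
  "qRe (x - y) = qRe x - qRe y"
| "qIm1 (x - y) = qIm1 x - qIm1 y"
| "qIm2 (x - y) = qIm2 x - qIm2 y"
| "qIm3 (x - y) = qIm3 x - qIm3 y"

instance
  by standard (simp_all add: quat_eq_iff)

end

instantiation quat :: ring_1
begin

primcorec one_quat where
  "qRe 1 = 1" | "qIm1 1 = 0" | "qIm2 1 = 0" | "qIm3 1 = 0"

primcorec times_quat where
  "qRe (x * y) = qRe x * qRe y - qIm1 x * qIm1 y - qIm2 x * qIm2 y - qIm3 x * qIm3 y"
| "qIm1 (x * y) = qRe x * qIm1 y + qIm1 x * qRe y + qIm2 x * qIm3 y - qIm3 x * qIm2 y"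
| "qIm2 (x * y) = qRe x * qIm2 y - qIm1 x * qIm3 y + qIm2 x * qRe y + qIm3 x * qIm1 y"
| "qIm3 (x * y) = qRe x * qIm3 y + qIm1 x * qIm2 y - qIm2 x * qIm1 y + qIm3 x * qRe y"

instance
  by standard (simp_all add: quat_eq_iff algebra_simps)

end

instantiation quat :: real_algebra_1
begin

primcorec scaleR_quat where
  "qRe (r *\<^sub>R x) = r * qRe x"
| "qIm1 (r *\<^sub>R x) = r * qIm1 x"
| "qIm2 (r *\<^sub>R x) = r * qIm2 x"
| "qIm3 (r *\<^sub>R x) = r * qIm3 x"

instance
  by standard (simp_all add: quat_eq_iff algebra_simps)

end

instantiation quat :: real_inner
begin

definition inner_quat :: "quat \<Rightarrow> quat \<Rightarrow> real" where
  "inner_quat x y = qRe x * qRe y + qIm1 x * qIm1 y + qIm2 x * qIm2 y + qIm3 x * qIm3 y"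

definition norm_quat :: "quat \<Rightarrow> real" where
  "norm_quat x = sqrt (inner x x)"

definition sgn_quat :: "quat \<Rightarrow> quat" where
  "sgn_quat x = x /\<^sub>R norm x"

definition dist_quat :: "quat \<Rightarrow> quat \<Rightarrow> real" where
  "dist_quat x y = norm (x - y)"

definition uniformity_quat :: "(quat \<times> quat) filter" where
  "uniformity_quat = (INF e\<in>{0<..}. principal {(x, y). dist x y < e})"

definition open_quat :: "quat set \<Rightarrow> bool" where
  "open_quat U \<longleftrightarrow> (\<forall>x\<in>U. eventually (\<lambda>(x', y). x' = x \<longrightarrow> y \<in> U) uniformity)"

instance
proof
  fix x y z :: quat and r :: real and U :: "quat set"
  show "sgn x = x /\<^sub>R norm x" by (fact sgn_quat_def)
  show "dist x y = norm (x - y)" by (fact dist_quat_def)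
  show "uniformity = (INF e\<in>{0<..}. principal {(x :: quat, y). dist x y < e})"
    by (fact uniformity_quat_def)
  show "open U \<longleftrightarrow> (\<forall>x\<in>U. eventually (\<lambda>(x', y). x' = x \<longrightarrow> y \<in> U) uniformity)"
    by (fact open_quat_def)
  show "inner x y = inner y x" by (simp add: inner_quat_def mult.commute)
  show "inner (x + y) z = inner x z + inner y z"
    by (simp add: inner_quat_def algebra_simps)
  show "inner (r *\<^sub>R x) y = r * inner x y"
    by (simp add: inner_quat_def algebra_simps)
  show "0 \<le> inner x x" by (simp add: inner_quat_def)
  show "inner x x = 0 \<longleftrightarrow> x = 0"
    by (simp add: inner_quat_def quat_eq_iff add_nonneg_eq_0_iff)
  show "norm x = sqrt (inner x x)" by (fact norm_quat_def)
qed

end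

instance quat :: real_normed_algebra_1
proof
  fix x y :: quat
  have "inner (x * y) (x * y) = inner x x * inner y y"
    unfolding inner_quat_def times_quat.sel by algebra
  then show "norm (x * y) \<le> norm x * norm y"
    by (simp add: norm_quat_def real_sqrt_mult)
  show "norm (1 :: quat) = 1" by (simp add: norm_quat_def inner_quat_def)
qed

definition quat_i :: quat where "quat_i = Quat 0 1 0 0"
definition quat_j :: quat where "quat_j = Quat 0 0 1 0"
definition quat_k :: quat where "quat_k = Quat 0 0 0 1"

lemma quat_units:
  "quat_i * quat_i = -1" "quat_j * quat_j = -1" "quat_k * quat_k = -1"
  "quat_i * quat_j = quat_k" "quat_j * quat_i = - quat_k"
  "quat_j * quat_k = quat_i" "quat_k * quat_j = - quat_i"
  "quat_k * quat_i = quat_j" "quat_i * quat_k = - quat_j"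
  by (simp_all add: quat_eq_iff quat_i_def quat_j_def quat_k_def)

instantiation quat :: euclidean_space
begin

definition Basis_quat :: "quat set" where
  "Basis_quat = {1, quat_i, quat_j, quat_k}"

instance
proof
  show "(Basis :: quat set) \<noteq> {}" by (simp add: Basis_quat_def)
  show "finite (Basis :: quat set)" by (simp add: Basis_quat_def)
  fix u v x :: quat
  show "u \<in> Basis \<Longrightarrow> v \<in> Basis \<Longrightarrow> inner u v = (if u = v then 1 else 0)"
    by (auto simp: Basis_quat_def quat_eq_iff inner_quat_def quat_i_def quat_j_def quat_k_def)
  show "(\<forall>u\<in>Basis. inner x u = 0) \<longleftrightarrow> x = 0"
    unfolding Basis_quat_def ball_simps
    by (simp add: inner_quat_def quat_i_def quat_j_def quat_k_def)
      (simp add: quat_eq_iff)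
qed

end

primcorec qcnj :: "quat \<Rightarrow> quat" where
  "qRe (qcnj x) = qRe x"
| "qIm1 (qcnj x) = - qIm1 x"
| "qIm2 (qcnj x) = - qIm2 x"
| "qIm3 (qcnj x) = - qIm3 x"


section \<open>Square-integrable functions, ambiguity function and entropy\<close>

definition mu :: "'a::euclidean_space measure" where
  "mu = density lebesgue (\<lambda>_. ennreal (1 / (2 * pi) powr (real DIM('a) / 2)))"

definition square_integrable :: "('a::euclidean_space \<Rightarrow> quat) \<Rightarrow> bool" where
  "square_integrable f \<longleftrightarrow> f \<in> borel_measurable mu \<and> integrable mu (\<lambda>x. (norm (f x))\<^sup>2)"

definition L2_norm :: "('a::euclidean_space \<Rightarrow> quat) \<Rightarrow> real" where
  "L2_norm f = sqrt (LINT x|mu. (norm (f x))\<^sup>2)"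

text \<open>
  The space $\mathbb{R}^{2d} = \mathbb{R}^d \times \mathbb{R}^d$ is the product type below, and
  \<^term>\<open>exp\<close> is the exponential series in the algebra of quaternions.
\<close>

definition ambiguity ::
    "((real^'d) \<times> (real^'d) \<Rightarrow> quat) \<Rightarrow> ((real^'d) \<times> (real^'d) \<Rightarrow> quat) \<Rightarrow>
      (real^'d) \<times> (real^'d) \<Rightarrow> (real^'d) \<times> (real^'d) \<Rightarrow> quat" where
  "ambiguity f g x w =
    (LINT t|mu. exp (- ((fst t \<bullet> fst w) *\<^sub>R quat_i)) *
       f (t + (1/2) *\<^sub>R x) * qcnj (g (t - (1/2) *\<^sub>R x)) *
       exp (- ((snd t \<bullet> snd w) *\<^sub>R quat_j)))"

text \<open>
  The integral of $-P \ln P$ is formed as an extended real from the integrals of the positive and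
  negative parts of $P \ln P$ (recall that \<^prop>\<open>ln 0 = (0::real)\<close>).  In \<^typ>\<open>ereal\<close> the
  difference \<^term>\<open>\<infinity> - \<infinity> :: ereal\<close> is \<^term>\<open>\<infinity> :: ereal\<close>, so the outer minus sign makes the
  entropy \<^term>\<open>-\<infinity> :: ereal\<close> whenever the positive part of $P \ln P$ has infinite integral: a lower
  bound on the entropy by a real number never holds because of an indeterminate difference.
\<close>

definition entropy :: "('a::euclidean_space \<Rightarrow> real) \<Rightarrow> ereal" where
  "entropy P =
    - (enn2ereal (\<integral>\<^sup>+z. ennreal (ln (P z) * P z) \<partial>mu) -
       enn2ereal (\<integral>\<^sup>+z. ennreal (- (ln (P z) * P z)) \<partial>mu))"

end

theory Submission
  imports Defs "HOL-Probability.Characteristic_Functions"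
begin

text \<open>
  Let \<open>N = \<parallel>f\<parallel>\<^sup>2 \<parallel>g\<parallel>\<^sup>2\<close> and \<open>P = |A(f,g)|\<^sup>2\<close>.  By Plancherel the integral of \<open>P\<close> is \<open>N\<close>, so
  by Jensen's inequality the entropy is bounded below as soon as the integral of \<open>P\<^sup>2\<close>, a fourth
  power norm of \<open>A(f,g)\<close>, is at most \<open>N\<^sup>2 / 4^d\<close>.  For this the transform in \<open>t1\<close> (left multiplication
  by exponentials of \<open>i\<close>) is estimated first: since \<open>|A|\<^sup>4\<close> is the square of a bilinear expression, its
  integral over \<open>w1\<close> is at most an integral over \<open>a1 + a2 = a3 + a4\<close> of products of four norms of
  the transform in \<open>t2\<close>.  The Cauchy-Schwarz inequality over \<open>(x2, w2)\<close> reduces these to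
  products of two squares, to which the same estimate applies with right multiplication by
  exponentials of \<open>j\<close>.  What remains, in both rounds, is an integral over \<open>x\<close> and \<open>a1 + a2 = a3 + a4\<close>
  of \<open>\<Prod> F(a_k) G(a_k - x)\<close>; by \<open>2ab \<le> a\<^sup>2 + b\<^sup>2\<close> it is at most the integral of
  \<open>F(a1)\<^sup>2 F(a2)\<^sup>2 G(a3 - x)\<^sup>2 G(a4 - x)\<^sup>2\<close>, and the substitution \<open>a3 = y3 + x\<close>, \<open>a4 = y4 + x\<close> turns the
  constraint into one on \<open>2x\<close>, which produces the factor \<open>2^{-d}\<close>.  Gaussian weights in \<open>w\<close> replace the
  constraint by a Gaussian kernel, so that all integrals converge absolutely.
\<close>

section \<open>Quaternions and the normalized Lebesgue measure\<close>

text \<open>Euler's four-square identity. The equality makes multiplication by a unit an isometry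
  and the norm of \<open>hprod\<close> a product.\<close>

lemma norm_quat_mult: "norm (x * y) = norm x * norm (y :: quat)"
proof -
  have "inner (x * y) (x * y) = inner x x * inner y y"
    unfolding inner_quat_def times_quat.sel by algebra
  then show ?thesis
    by (simp add: norm_quat_def real_sqrt_mult)
qed

lemma norm_qcnj [simp]: "norm (qcnj x) = norm x"
  by (simp add: norm_quat_def inner_quat_def)

text \<open>Euler's formula: the powers of \<open>u\<close> have period 4 with the same signs as
  \<open>cos_coeff\<close> and \<open>sin_coeff\<close>, so the exponential series splits into a
  multiple of 1 and a multiple of \<open>u\<close>.\<close>

lemma exp_scaleR_imaginary_unit:
  fixes u :: "'a :: {real_normed_algebra_1, banach}"
  assumes u: "u * u = -1"
  shows "exp (b *\<^sub>R u) = cos b *\<^sub>R 1 + sin b *\<^sub>R u"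
proof -
  have *: "(b *\<^sub>R u) ^ n /\<^sub>R fact n = (cos_coeff n * b^n) *\<^sub>R 1 + (sin_coeff n * b^n) *\<^sub>R u" for n
  proof -
    have "u ^ n = fact n *\<^sub>R (cos_coeff n *\<^sub>R 1 + sin_coeff n *\<^sub>R u)"
    proof (induct n)
      case (Suc n)
      have "fact (Suc n) * cos_coeff (Suc n) = - (fact n * sin_coeff n)"
        "fact (Suc n) * sin_coeff (Suc n) = fact n * cos_coeff n"
        by (simp_all add: sin_coeff_Suc cos_coeff_Suc del: of_nat_Suc)
      then show ?case
        using Suc by (simp add: u scaleR_add_right distrib_left del: fact_Suc)
    qed simp
    then show ?thesis
      by (simp add: scaleR_add_right field_simps)
  qed
  have "(\<lambda>n. (cos_coeff n *\<^sub>R b^n) *\<^sub>R (1::'a) + (sin_coeff n *\<^sub>R b^n) *\<^sub>R u) sums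
      (cos b *\<^sub>R 1 + sin b *\<^sub>R u)"
    by (intro sums_add sums_scaleR_left sin_converges cos_converges)
  then have "(\<lambda>n. (b *\<^sub>R u) ^ n /\<^sub>R fact n) sums (cos b *\<^sub>R 1 + sin b *\<^sub>R u)"
    by (simp add: * del: scaleR_power)
  then show ?thesis
    unfolding exp_def by (rule sums_unique[symmetric])
qed

section \<open>The normalized Lebesgue measure on Borel sets and affine substitutions\<close>

definition nu :: "'a::euclidean_space measure" where
  "nu = density lborel (\<lambda>_. ennreal (1 / (2 * pi) powr (real DIM('a) / 2)))"

lemma sets_nu [simp, measurable_cong]: "sets nu = sets borel"
  by (simp add: nu_def)

lemma space_nu [simp]: "space nu = UNIV"
  by (simp add: nu_def)

lemma sigma_finite_nu: "sigma_finite_measure nu"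
  unfolding nu_def
  by (subst sigma_finite_measure.sigma_finite_iff_density_finite[OF sigma_finite_lborel]) auto

global_interpretation nu: sigma_finite_measure nu
  by (rule sigma_finite_nu)

global_interpretation nunu: pair_sigma_finite nu nu
  by standard

lemma nn_integral_nu:
  fixes f :: "'a::euclidean_space \<Rightarrow> ennreal"
  assumes [measurable]: "f \<in> borel_measurable borel"
  shows "(\<integral>\<^sup>+x. f x \<partial>nu) =
    ennreal (1 / (2 * pi) powr (real DIM('a) / 2)) * (\<integral>\<^sup>+x. f x \<partial>lborel)"
  unfolding nu_def by (subst nn_integral_density) (auto simp: nn_integral_cmult)

lemma integral_nu:
  fixes f :: "'a::euclidean_space \<Rightarrow> 'b :: {banach, second_countable_topology}"
  assumes [measurable]: "f \<in> borel_measurable borel"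
  shows "(LINT x|nu. f x) = (1 / (2 * pi) powr (real DIM('a) / 2)) *\<^sub>R (LINT x|lborel. f x)"
  unfolding nu_def by (subst integral_density) auto

text \<open>The normalizing powers of \<open>2 * pi\<close> multiply, as dimensions add. This is the
  reason for working with \<open>nu\<close> on Borel sets instead of \<open>mu\<close>: a product of
  completed measures is not complete in general, whereas here Tonelli and Fubini apply directly on
  product types.\<close>

lemma nu_pair: "nu \<Otimes>\<^sub>M nu = (nu :: ('a::euclidean_space \<times> 'b::euclidean_space) measure)"
proof -
  have *: "ennreal (1 / (2 * pi) powr (real DIM('a) / 2)) * ennreal (1 / (2 * pi) powr (real DIM('b) / 2))
      = ennreal (1 / (2 * pi) powr (real DIM('a \<times> 'b) / 2))"
    by (subst ennreal_mult[symmetric]) (auto simp: powr_add[symmetric] add_divide_distrib)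
  show ?thesis
    unfolding nu_def
    by (subst pair_measure_density)
       (auto simp: * lborel_prod sigma_finite_lborel sigma_finite_nu[unfolded nu_def]
             intro!: arg_cong[where f="density lborel"])
qed

lemma nn_integral_nu_affine:
  fixes f :: "'a::euclidean_space \<Rightarrow> ennreal"
  assumes [measurable]: "f \<in> borel_measurable borel" and c: "c \<noteq> 0"
  shows "(\<integral>\<^sup>+x. f (t + c *\<^sub>R x) \<partial>nu) = ennreal (1 / \<bar>c\<bar> ^ DIM('a)) * (\<integral>\<^sup>+x. f x \<partial>nu)"
proof -
  have "(\<integral>\<^sup>+x. f x \<partial>lborel) = ennreal (\<bar>c\<bar> ^ DIM('a)) * (\<integral>\<^sup>+x. f (t + c *\<^sub>R x) \<partial>lborel)"
    using c by (subst lborel_affine[of c t])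
      (auto simp: nn_integral_density nn_integral_distr nn_integral_cmult)
  then have *: "ennreal (1 / \<bar>c\<bar> ^ DIM('a)) * (\<integral>\<^sup>+x. f x \<partial>lborel) =
     ennreal (1 / \<bar>c\<bar> ^ DIM('a)) * ennreal (\<bar>c\<bar> ^ DIM('a)) * (\<integral>\<^sup>+x. f (t + c *\<^sub>R x) \<partial>lborel)"
    by (simp add: mult.assoc)
  also have "ennreal (1 / \<bar>c\<bar> ^ DIM('a)) * ennreal (\<bar>c\<bar> ^ DIM('a)) = 1"
    using c by (subst ennreal_mult[symmetric]) auto
  finally have "ennreal (1 / \<bar>c\<bar> ^ DIM('a)) * (\<integral>\<^sup>+x. f x \<partial>lborel) =
     (\<integral>\<^sup>+x. f (t + c *\<^sub>R x) \<partial>lborel)"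
    by simp
  then show ?thesis
    by (simp add: nn_integral_nu mult.left_commute[of "ennreal (1 / \<bar>c\<bar> ^ DIM('a))"])
qed

lemma integral_nu_affine:
  fixes f :: "'a::euclidean_space \<Rightarrow> 'b :: {banach, second_countable_topology}"
  assumes [measurable]: "f \<in> borel_measurable borel" and c: "c \<noteq> 0"
  shows "(LINT x|nu. f (t + c *\<^sub>R x)) = (1 / \<bar>c\<bar> ^ DIM('a)) *\<^sub>R (LINT x|nu. f x)"
proof -
  have "(LINT x|lborel. f x) = (\<bar>c\<bar> ^ DIM('a)) *\<^sub>R (LINT x|lborel. f (t + c *\<^sub>R x))"
    using c by (subst lborel_affine[of c t]) (auto simp: integral_density integral_distr)
  then show ?thesis
    using c by (simp add: integral_nu)
qed

lemma nn_integral_nu_shift: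
  fixes f :: "'a::euclidean_space \<Rightarrow> ennreal"
  assumes [measurable]: "f \<in> borel_measurable borel"
  shows "(\<integral>\<^sup>+x. f (x + t) \<partial>nu) = (\<integral>\<^sup>+x. f x \<partial>nu)"
  using nn_integral_nu_affine[of f 1 t] by (simp add: add.commute)

lemma nn_integral_nu_reflect:
  fixes f :: "'a::euclidean_space \<Rightarrow> ennreal"
  assumes [measurable]: "f \<in> borel_measurable borel"
  shows "(\<integral>\<^sup>+x. f (t - x) \<partial>nu) = (\<integral>\<^sup>+x. f x \<partial>nu)"
  using nn_integral_nu_affine[of f "-1" t] by simp

section \<open>Gaussian weights and their Fourier transforms\<close>

definition gauss :: "'a::euclidean_space \<Rightarrow> real" where
  "gauss x = exp (- (norm x)\<^sup>2 / 2)"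

lemma gauss_nonneg [simp]: "0 \<le> gauss x" and gauss_le_1: "gauss x \<le> 1"
  and gauss_minus [simp]: "gauss (- x) = gauss x"
  by (auto simp: gauss_def)

lemma gauss_Pair: "gauss (x, y) = gauss x * gauss y"
  by (simp add: gauss_def norm_Pair exp_add[symmetric] add_divide_distrib)

lemma borel_measurable_gauss [measurable]: "gauss \<in> borel_measurable borel"
  unfolding gauss_def[abs_def] by measurable

lemma gauss_prod: "gauss x = (\<Prod>b\<in>Basis. exp (- (x \<bullet> b)\<^sup>2 / 2))"
proof -
  have "(norm x)\<^sup>2 = (\<Sum>b\<in>Basis. (x \<bullet> b)\<^sup>2)"
    unfolding power2_norm_eq_inner by (subst euclidean_inner) (simp add: power2_eq_square)
  then show ?thesis
    by (simp add: gauss_def exp_sum[symmetric] sum_divide_distrib sum_negf)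
qed

text \<open>This is the characteristic function of the standard normal distribution, rescaled by
  \<open>sqrt (2 * pi)\<close>.\<close>

lemma gauss_transform_1dim:
  "integrable lborel (\<lambda>x. cis (s * x) * complex_of_real (exp (- x\<^sup>2 / 2)))"
  "(LINT x|lborel. cis (s * x) * complex_of_real (exp (- x\<^sup>2 / 2))) =
     complex_of_real (sqrt (2 * pi) * exp (- s\<^sup>2 / 2))"
proof -
  have "complex_of_real (exp (- (s^2) / 2)) = char std_normal_distribution s"
    by (simp add: char_std_normal_distribution)
  also have "\<dots> = (LINT x|lborel. std_normal_density x *\<^sub>R iexp (s * x))"
    unfolding char_def by (subst integral_density) (auto simp: normal_density_nonneg)
  also have "\<dots> = (LINT x|lborel. complex_of_real (1 / sqrt (2 * pi)) *
      (cis (s * x) * complex_of_real (exp (- x\<^sup>2 / 2))))"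
    by (simp add: std_normal_density_def cis_conv_exp scaleR_conv_of_real mult_ac)
  also have "\<dots> = complex_of_real (1 / sqrt (2 * pi)) *
      (LINT x|lborel. cis (s * x) * complex_of_real (exp (- x\<^sup>2 / 2)))"
    by (rule integral_mult_right_zero)
  finally show "(LINT x|lborel. cis (s * x) * complex_of_real (exp (- x\<^sup>2 / 2))) =
     complex_of_real (sqrt (2 * pi) * exp (- s\<^sup>2 / 2))"
    by (simp add: field_simps)
  have "integrable lborel (\<lambda>x. sqrt (2 * pi) * std_normal_density x)"
    by (intro integrable_mult_right) (use integrable_normal_moment[of 1 0 0] in simp)
  then have "integrable lborel (\<lambda>x::real. exp (- x\<^sup>2 / 2))"
    by (simp add: std_normal_density_def)
  then show "integrable lborel (\<lambda>x. cis (s * x) * complex_of_real (exp (- x\<^sup>2 / 2)))"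
    by (rule Bochner_Integration.integrable_bound) (auto simp: norm_mult cis_conv_exp)
qed

text \<open>With the normalization of \<open>nu\<close> the Gaussian is its own Fourier transform.
  The integrand factors over the coordinates, and \<open>lborel_eq\<close> presents Lebesgue measure
  as the image of a product of one-dimensional ones.\<close>

lemma gauss_transform_complex:
  fixes s :: "'a::euclidean_space"
  shows "integrable nu (\<lambda>x. cis (s \<bullet> x) * complex_of_real (gauss x))"
    and "(LINT x|nu. cis (s \<bullet> x) * complex_of_real (gauss x)) = complex_of_real (gauss s)"
proof -
  interpret product_sigma_finite "\<lambda>b::'a. lborel :: real measure"
    using sigma_finite_lborel by (simp add: product_sigma_finite_def)
  let ?f = "\<lambda>b x. cis ((s \<bullet> b) * x) * complex_of_real (exp (- x\<^sup>2 / 2))"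
  have cis_sum: "cis (sum g A) = (\<Prod>b\<in>A. cis (g b))" if "finite A" for g and A :: "'a set"
    using that by induction (auto simp: cis_mult[symmetric])
  have eq: "cis (s \<bullet> x) * complex_of_real (gauss x) = (\<Prod>b\<in>Basis. ?f b (x \<bullet> b))" for x
    by (simp add: gauss_prod prod.distrib euclidean_inner[of s x] cis_sum)
  have L: "(lborel :: 'a measure) =
      distr (\<Pi>\<^sub>M b\<in>Basis. lborel) borel (\<lambda>f. \<Sum>b\<in>Basis. f b *\<^sub>R b)"
    by (rule lborel_eq)
  have [measurable]: "(\<lambda>x::real. cis x) \<in> borel_measurable borel"
    by (intro borel_measurable_continuous_onI continuous_intros)
  have eq': "cis (s \<bullet> (\<Sum>b\<in>Basis. f b *\<^sub>R b)) * complex_of_real (gauss (\<Sum>b\<in>Basis. f b *\<^sub>R b)) =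
      (\<Prod>b\<in>Basis. ?f b (f b))" for f
    unfolding eq by (intro prod.cong) auto
  have "integrable lborel (\<lambda>x. cis (s \<bullet> x) * complex_of_real (gauss x))"
    by (subst L, subst integrable_distr_eq, simp, simp)
       (simp only: eq', rule product_integrable_prod, simp, rule gauss_transform_1dim)
  then show "integrable nu (\<lambda>x. cis (s \<bullet> x) * complex_of_real (gauss x))"
    unfolding nu_def by (subst integrable_density) auto
  have "(LINT x|lborel. cis (s \<bullet> x) * complex_of_real (gauss x)) =
      (\<Prod>b\<in>Basis. complex_of_real (sqrt (2 * pi) * exp (- (s \<bullet> b)\<^sup>2 / 2)))"
    by (subst L, subst integral_distr, simp, simp)
       (simp only: eq', subst product_integral_prod, simp, rule gauss_transform_1dim,
         simp only: gauss_transform_1dim)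
  also have "\<dots> = complex_of_real (sqrt (2 * pi) ^ DIM('a) * gauss s)"
    by (simp add: gauss_prod prod.distrib)
  also have "sqrt (2 * pi) ^ DIM('a) = (2 * pi) powr (real DIM('a) / 2)"
    using powr_powr[of "2 * pi" "1/2" "real DIM('a)"] by (simp add: powr_half_sqrt powr_realpow)
  finally show "(LINT x|nu. cis (s \<bullet> x) * complex_of_real (gauss x)) = complex_of_real (gauss s)"
    by (subst integral_nu) (auto simp: scaleR_conv_of_real)
qed

lemma gauss_transform:
  fixes s :: "'a::euclidean_space"
  shows "integrable nu (gauss :: 'a \<Rightarrow> real)"
    and "(LINT x|nu. gauss x * cos (s \<bullet> x)) = gauss s"
    and "(LINT x|nu. gauss x * sin (s \<bullet> x)) = 0"
proof -
  note I = gauss_transform_complex[of s]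
  show "integrable nu (gauss :: 'a \<Rightarrow> real)"
    using integrable_norm[OF I(1)] by (simp add: norm_mult)
  show "(LINT x|nu. gauss x * cos (s \<bullet> x)) = gauss s"
    using integral_Re[OF I(1)] I(2) by (simp add: mult.commute)
  show "(LINT x|nu. gauss x * sin (s \<bullet> x)) = 0"
    using integral_Im[OF I(1)] I(2) by (simp add: mult.commute)
qed

text \<open>The Fourier transform of the weight \<open>gauss (e *\<^sub>R w)\<close>, see
  \<open>gker_transform\<close>; an approximate identity for \<open>nu\<close> as \<open>e\<close>
  tends to 0.\<close>

definition gker :: "real \<Rightarrow> 'a::euclidean_space \<Rightarrow> real" where
  "gker e s = gauss ((1 / e) *\<^sub>R s) / e ^ DIM('a)"

lemma gker_nonneg: "0 < e \<Longrightarrow> 0 \<le> gker e s"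
  by (simp add: gker_def)

lemma gker_minus [simp]: "gker e (- s) = gker e s"
  by (simp add: gker_def)

lemma gker_minus_commute: "gker e (x - y) = gker e (y - x)"
  using gker_minus[of e "x - y"] by simp

lemma borel_measurable_gker [measurable]: "gker e \<in> borel_measurable borel"
  unfolding gker_def[abs_def] by measurable

lemma gker_transform:
  fixes s :: "'a::euclidean_space"
  assumes "0 < e"
  shows "integrable nu (\<lambda>x::'a. gauss (e *\<^sub>R x))"
    and "(LINT x|nu. gauss (e *\<^sub>R x) * cos (s \<bullet> x)) = gker e s"
    and "(LINT x|nu. gauss (e *\<^sub>R x) * sin (s \<bullet> x)) = 0"
proof -
  have "(\<integral>\<^sup>+x. ennreal (gauss (0 + e *\<^sub>R (x::'a))) \<partial>nu) < \<infinity>"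
    using assms gauss_transform(1)[where 'a='a] unfolding integrable_iff_bounded
    by (subst nn_integral_nu_affine) (auto simp: ennreal_mult_less_top)
  then show "integrable nu (\<lambda>x::'a. gauss (e *\<^sub>R x))"
    by (auto simp: integrable_iff_bounded)
  show "(LINT x|nu. gauss (e *\<^sub>R x) * cos (s \<bullet> x)) = gker e s"
    using assms integral_nu_affine[of "\<lambda>x. gauss x * cos (((1/e) *\<^sub>R s) \<bullet> x)" e 0]
      gauss_transform(2)[of "(1/e) *\<^sub>R s"]
    by (simp add: gker_def)
  show "(LINT x|nu. gauss (e *\<^sub>R x) * sin (s \<bullet> x)) = 0"
    using assms integral_nu_affine[of "\<lambda>x. gauss x * sin (((1/e) *\<^sub>R s) \<bullet> x)" e 0]
      gauss_transform(3)[of "(1/e) *\<^sub>R s"]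
    by simp
qed

lemma nn_integral_gauss: "(\<integral>\<^sup>+x. ennreal (gauss (x::'a::euclidean_space)) \<partial>nu) = 1"
proof -
  have "(\<integral>\<^sup>+x. ennreal (gauss (x::'a)) \<partial>nu) = ennreal (LINT x|nu. gauss x * cos ((0::'a) \<bullet> x))"
    using gauss_transform(1) by (subst nn_integral_eq_integral) auto
  then show ?thesis
    by (subst (asm) gauss_transform(2)) (simp add: gauss_def)
qed

text \<open>The kernel has mass 1, so only the Jacobian is left. At \<open>c = -2\<close> it is the
  source of the constant in the fourth power bound.\<close>

lemma nn_integral_gker_affine:
  assumes "0 < e" "c \<noteq> 0"
  shows "(\<integral>\<^sup>+x. ennreal (gker e (t + c *\<^sub>R (x::'a::euclidean_space))) \<partial>nu) =
    ennreal (1 / \<bar>c\<bar> ^ DIM('a))"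
proof -
  have 1: "(\<integral>\<^sup>+x. ennreal (gker e (x::'a)) \<partial>nu) = 1"
  proof -
    have "(\<integral>\<^sup>+x. ennreal (gker e (x::'a)) \<partial>nu) =
      (\<integral>\<^sup>+x. ennreal (1 / e ^ DIM('a)) * ennreal (gauss (0 + (1 / e) *\<^sub>R (x::'a))) \<partial>nu)"
      using assms unfolding gker_def by (subst ennreal_mult[symmetric]) auto
    also have "\<dots> = ennreal (1 / e ^ DIM('a)) * ennreal (1 / \<bar>1 / e\<bar> ^ DIM('a))"
      using assms by (subst nn_integral_cmult, simp, subst nn_integral_nu_affine)
        (auto simp: nn_integral_gauss)
    also have "\<dots> = 1"
      using assms by (subst ennreal_mult[symmetric]) (auto simp: field_simps)
    finally show ?thesis .
  qed
  show ?thesis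
    using assms by (subst nn_integral_nu_affine) (auto simp: 1)
qed

section \<open>Tonelli and Fubini for the normalized measure\<close>

lemma borel_measurable_fst' [measurable]: "fst \<in> borel_measurable borel"
  and borel_measurable_snd' [measurable]: "snd \<in> borel_measurable borel"
  by (intro borel_measurable_continuous_onI continuous_intros)+

lemma nn_integral_nu_pair:
  fixes f :: "'a::euclidean_space \<times> 'b::euclidean_space \<Rightarrow> ennreal"
  assumes [measurable]: "f \<in> borel_measurable borel"
  shows "(\<integral>\<^sup>+z. f z \<partial>nu) = (\<integral>\<^sup>+x. \<integral>\<^sup>+y. f (x, y) \<partial>nu \<partial>nu)"
proof -
  have "f \<in> borel_measurable (nu \<Otimes>\<^sub>M nu)"
    by (simp add: nu_pair)
  from nu.nn_integral_fst[OF this] show ?thesis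
    by (simp add: nu_pair)
qed

lemma nn_integral_nu_Fubini:
  fixes f :: "'a::euclidean_space \<Rightarrow> 'b::euclidean_space \<Rightarrow> ennreal"
  assumes [measurable]: "case_prod f \<in> borel_measurable borel"
  shows "(\<integral>\<^sup>+x. \<integral>\<^sup>+y. f x y \<partial>nu \<partial>nu) = (\<integral>\<^sup>+y. \<integral>\<^sup>+x. f x y \<partial>nu \<partial>nu)"
proof -
  have "case_prod f \<in> borel_measurable (nu \<Otimes>\<^sub>M nu)"
    by (simp add: nu_pair)
  from nunu.Fubini'[OF this] show ?thesis ..
qed

lemma nn_integral_nu_times:
  fixes f :: "'a::euclidean_space \<Rightarrow> ennreal" and g :: "'b::euclidean_space \<Rightarrow> ennreal"
  assumes [measurable]: "f \<in> borel_measurable borel" "g \<in> borel_measurable borel"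
  shows "(\<integral>\<^sup>+z. f (fst z) * g (snd z) \<partial>nu) = (\<integral>\<^sup>+x. f x \<partial>nu) * (\<integral>\<^sup>+y. g y \<partial>nu)"
  by (simp add: nn_integral_nu_pair nn_integral_cmult nn_integral_multc)

lemma nn_integral_nu_swap:
  fixes f :: "'a::euclidean_space \<times> 'b::euclidean_space \<Rightarrow> ennreal"
  assumes [measurable]: "f \<in> borel_measurable borel"
  shows "(\<integral>\<^sup>+z. f (snd z, fst z) \<partial>nu) = (\<integral>\<^sup>+z. f z \<partial>nu)"
  by (simp add: nn_integral_nu_pair) (subst nn_integral_nu_Fubini, auto)

lemma integrable_nu_times:
  fixes f :: "'a::euclidean_space \<Rightarrow> real" and g :: "'b::euclidean_space \<Rightarrow> real"
  assumes f: "integrable nu f" and g: "integrable nu g"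
  shows "integrable nu (\<lambda>z. f (fst z) * g (snd z))"
proof -
  have [measurable]: "f \<in> borel_measurable borel" "g \<in> borel_measurable borel"
    using f g by (auto dest: borel_measurable_integrable)
  have "(\<integral>\<^sup>+z. ennreal (norm (f (fst z))) * ennreal (norm (g (snd z))) \<partial>nu) < \<infinity>"
    using f g by (subst nn_integral_nu_times) (auto simp: integrable_iff_bounded ennreal_mult_less_top)
  then show ?thesis
    by (auto simp: integrable_iff_bounded abs_mult ennreal_mult)
qed

lemma integral_nu_pair:
  fixes f :: "'a::euclidean_space \<times> 'b::euclidean_space \<Rightarrow> 'c :: {banach, second_countable_topology}"
  assumes "integrable nu f"
  shows "(LINT z|nu. f z) = (LINT x|nu. LINT y|nu. f (x, y))"
    and "(LINT z|nu. f z) = (LINT y|nu. LINT x|nu. f (x, y))"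
    and "AE x in nu. integrable nu (\<lambda>y. f (x, y))"
    and "integrable nu (\<lambda>y. LINT x|nu. f (x, y))"
proof -
  have f: "integrable (nu \<Otimes>\<^sub>M nu) f"
    using assms by (simp add: nu_pair)
  show "(LINT z|nu. f z) = (LINT x|nu. LINT y|nu. f (x, y))"
    using nunu.integral_fst'[OF f] by (simp add: nu_pair)
  have f': "integrable (nu \<Otimes>\<^sub>M nu) (case_prod (\<lambda>x y. f (x, y)))"
    using f by simp
  show "(LINT z|nu. f z) = (LINT y|nu. LINT x|nu. f (x, y))"
    using nunu.integral_snd[OF f'] by (simp add: nu_pair)
  show "AE x in nu. integrable nu (\<lambda>y. f (x, y))"
    using nunu.AE_integrable_fst'[OF f] .
  show "integrable nu (\<lambda>y. LINT x|nu. f (x, y))"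
    using nunu.integrable_snd[OF f'] .
qed

text \<open>Turns the square of a transform into an absolutely convergent double integral, so that
  the integration over the frequency can be carried out first.\<close>

lemma norm_integral_squared:
  fixes X :: "'a::euclidean_space \<Rightarrow> 'q::euclidean_space"
  assumes X: "integrable nu X"
  shows "integrable nu (\<lambda>z. X (fst z) \<bullet> X (snd z))"
    and "(norm (LINT a|nu. X a))\<^sup>2 = (LINT z|nu. X (fst z) \<bullet> X (snd z))"
proof -
  have [measurable]: "X \<in> borel_measurable borel"
    using X by (auto dest: borel_measurable_integrable)
  show I: "integrable nu (\<lambda>z. X (fst z) \<bullet> X (snd z))"
    by (rule Bochner_Integration.integrable_bound[OF integrable_nu_times[OF integrable_norm[OF X] integrable_norm[OF X]]])
       (auto simp: Cauchy_Schwarz_ineq2)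
  have "(norm (LINT a|nu. X a))\<^sup>2 = (LINT a|nu. X a \<bullet> (LINT a|nu. X a))"
    using X by (simp add: power2_norm_eq_inner)
  also have "\<dots> = (LINT a|nu. LINT b|nu. X a \<bullet> X b)"
    using X by simp
  also have "\<dots> = (LINT z|nu. X (fst z) \<bullet> X (snd z))"
    using integral_nu_pair(1)[OF I] by simp
  finally show "(norm (LINT a|nu. X a))\<^sup>2 = (LINT z|nu. X (fst z) \<bullet> X (snd z))" .
qed

section \<open>Squares in the extended nonnegative reals and the convolution bound\<close>

lemma ennreal_power2_le_iff: "(x::ennreal)\<^sup>2 \<le> y\<^sup>2 \<longleftrightarrow> x \<le> y"
proof
  assume *: "x\<^sup>2 \<le> y\<^sup>2"
  show "x \<le> y"
  proof (cases x; cases y)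
    fix r s assume "x = ennreal r" "0 \<le> r" "y = ennreal s" "0 \<le> s"
    with * show ?thesis
      by (simp add: ennreal_power power2_le_iff_abs_le)
  qed (use * in \<open>auto simp: power2_eq_square ennreal_mult_eq_top_iff top_unique\<close>)
qed (simp add: power_mono)

text \<open>Defined at \<open>top\<close> as well, since the \<open>L^2\<close> norm of a slice may
  be infinite and \<open>esqrt_power2\<close> has to hold there too.\<close>

definition esqrt :: "ennreal \<Rightarrow> ennreal" where
  "esqrt x = (if x = top then top else ennreal (sqrt (enn2real x)))"

lemma esqrt_power2 [simp]: "(esqrt x)\<^sup>2 = x"
  by (cases x) (auto simp: esqrt_def ennreal_power power2_eq_square ennreal_mult_eq_top_iff simp flip: ennreal_mult)

lemma borel_measurable_esqrt [measurable]: "esqrt \<in> borel_measurable borel"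
  unfolding esqrt_def[abs_def] by measurable

text \<open>The pairs are \<open>((a1, a3), (a2, a4))\<close>, so the kernel is evaluated at
  \<open>a1 + a2 - a3 - a4\<close>.\<close>

definition qker :: "real \<Rightarrow> ('a::euclidean_space \<times> 'a) \<times> ('a \<times> 'a) \<Rightarrow> ennreal" where
  "qker e y = ennreal (gker e (fst (fst y) + fst (snd y) - snd (fst y) - snd (snd y)))"

lemma borel_measurable_qker [measurable]: "qker e \<in> borel_measurable borel"
  unfolding qker_def[abs_def] by measurable

lemma two_mult_le_ennreal:
  fixes x y :: ennreal shows "2 * (x * y) \<le> x\<^sup>2 + y\<^sup>2"
  by (cases x; cases y)
     (auto simp: power2_eq_square ennreal_mult_eq_top_iff ennreal_top_mult ennreal_mult_top
        ennreal_plus[symmetric] ennreal_mult[symmetric] ennreal_numeral[symmetric]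
        sum_squares_bound[unfolded power2_eq_square mult.assoc]
        simp del: ennreal_plus ennreal_numeral intro!: ennreal_leI)

text \<open>Write \<open>y = ((a1, a3), (a2, a4))\<close>. The factors are grouped as
  \<open>F1 a1 * F2 a2 * G1 (a3 - x) * G2 (a4 - x)\<close> times its mirror image under exchange of
  \<open>a1\<close> with \<open>a3\<close> and \<open>a2\<close> with \<open>a4\<close>. By
  \<open>2 * (p * q) \<le> p^2 + q^2\<close> two squares remain, and their integrals agree because
  the kernel is even.\<close>

lemma gaussian_convolution_bound:
  fixes F1 F2 G1 G2 :: "'a::euclidean_space \<Rightarrow> ennreal"
  assumes [measurable]: "F1 \<in> borel_measurable borel" "F2 \<in> borel_measurable borel"
    "G1 \<in> borel_measurable borel" "G2 \<in> borel_measurable borel" and e: "0 < e"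
  shows "(\<integral>\<^sup>+x. \<integral>\<^sup>+y. qker e y *
      (F1 (fst (fst y)) * G1 (fst (fst y) - x) * (F1 (snd (fst y)) * G1 (snd (fst y) - x)) *
      (F2 (fst (snd y)) * G2 (fst (snd y) - x) * (F2 (snd (snd y)) * G2 (snd (snd y) - x)))) \<partial>nu \<partial>nu)
    \<le> ennreal (1 / 2 ^ DIM('a)) *
      ((\<integral>\<^sup>+a. (F1 a)\<^sup>2 \<partial>nu) * (\<integral>\<^sup>+a. (G1 a)\<^sup>2 \<partial>nu) * ((\<integral>\<^sup>+a. (F2 a)\<^sup>2 \<partial>nu) * (\<integral>\<^sup>+a. (G2 a)\<^sup>2 \<partial>nu)))"
    (is "?L \<le> ?R")
proof -
  define T where "T x y = qker e y *
    ((F1 (fst (fst y)) * F2 (fst (snd y)) * G1 (snd (fst y) - x) * G2 (snd (snd y) - x))\<^sup>2)" for x y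
  have T_measurable [measurable]: "(\<lambda>z. T (fst z) (snd z)) \<in> borel_measurable borel"
    unfolding T_def by measurable
  have [measurable]: "(\<lambda>y. T x y) \<in> borel_measurable borel" for x
    unfolding T_def by measurable
  have [measurable]: "(\<lambda>x. integral\<^sup>N nu (T x)) \<in> borel_measurable borel"
    unfolding T_def by measurable
  have swap: "(\<integral>\<^sup>+y. T x ((snd (fst y), fst (fst y)), (snd (snd y), fst (snd y))) \<partial>nu) = (\<integral>\<^sup>+y. T x y \<partial>nu)" for x
  proof -
    have "(\<integral>\<^sup>+y. T x ((snd (fst y), fst (fst y)), (snd (snd y), fst (snd y))) \<partial>nu) =
        (\<integral>\<^sup>+u. \<integral>\<^sup>+v. T x ((snd u, fst u), (snd v, fst v)) \<partial>nu \<partial>nu)"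
      by (subst nn_integral_nu_pair) (auto simp: T_def)
    also have "\<dots> = (\<integral>\<^sup>+u. \<integral>\<^sup>+v. T x ((snd u, fst u), v) \<partial>nu \<partial>nu)"
      by (intro nn_integral_cong nn_integral_nu_swap[where f="\<lambda>v. T x ((snd u, fst u), v)" for u]) (auto simp: T_def)
    also have "\<dots> = (\<integral>\<^sup>+u. \<integral>\<^sup>+v. T x (u, v) \<partial>nu \<partial>nu)"
      by (intro nn_integral_nu_swap[where f="\<lambda>u. \<integral>\<^sup>+v. T x (u, v) \<partial>nu"]) (auto simp: T_def)
    also have "\<dots> = (\<integral>\<^sup>+y. T x y \<partial>nu)"
      by (subst nn_integral_nu_pair) (auto simp: T_def)
    finally show ?thesis .
  qed
  have main: "(\<integral>\<^sup>+x. \<integral>\<^sup>+y. T x y \<partial>nu \<partial>nu) = ?R"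
  proof -
    define S where "S y = (F1 (fst (fst y)))\<^sup>2 * (G1 (snd (fst y)))\<^sup>2 * ((F2 (fst (snd y)))\<^sup>2 * (G2 (snd (snd y)))\<^sup>2)" for y
    have [measurable]: "S \<in> borel_measurable borel"
      unfolding S_def by measurable
    \<comment> \<open>Shifting \<open>a3\<close> and \<open>a4\<close> by \<open>x\<close> frees the
      \<open>G\<close> factors of \<open>x\<close> and leaves the kernel at
      \<open>a1 + a2 - a3 - a4 - 2 x\<close>; integration over \<open>x\<close> first then gives
      \<open>1 / 2 ^ DIM('a)\<close> for every \<open>y\<close>.\<close>
    have "(\<integral>\<^sup>+y. T x y \<partial>nu) = (\<integral>\<^sup>+y. T x (y + ((0, x), (0, x))) \<partial>nu)" for x
      by (rule nn_integral_nu_shift[symmetric]) (simp add: T_def)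
    also have "\<dots>x = (\<integral>\<^sup>+y. ennreal (gker e (fst (fst y) + fst (snd y) - snd (fst y) - snd (snd y) + (-2) *\<^sub>R x)) * S y \<partial>nu)" for x
      unfolding T_def S_def qker_def
      by (intro nn_integral_cong arg_cong2[where f="(*)"])
         (auto simp: algebra_simps scaleR_2 power_mult_distrib)
    finally have "(\<integral>\<^sup>+x. \<integral>\<^sup>+y. T x y \<partial>nu \<partial>nu) =
      (\<integral>\<^sup>+y. \<integral>\<^sup>+x. ennreal (gker e (fst (fst y) + fst (snd y) - snd (fst y) - snd (snd y) + (-2) *\<^sub>R x)) * S y \<partial>nu \<partial>nu)"
      by (simp only:) (subst nn_integral_nu_Fubini, auto simp: case_prod_beta)
    also have "\<dots> = (\<integral>\<^sup>+y. ennreal (1 / 2 ^ DIM('a)) * S y \<partial>nu)"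
      using e nn_integral_gker_affine[where 'a='a and e=e and c="-2"] by (simp add: nn_integral_multc)
    also have "\<dots> = ?R"
      by (simp add: nn_integral_cmult S_def
        nn_integral_nu_times[where f="\<lambda>u. (F1 (fst u))\<^sup>2 * (G1 (snd u))\<^sup>2" and g="\<lambda>u. (F2 (fst u))\<^sup>2 * (G2 (snd u))\<^sup>2"]
        nn_integral_nu_times[where f="\<lambda>a. (F1 a)\<^sup>2" and g="\<lambda>a. (G1 a)\<^sup>2"]
        nn_integral_nu_times[where f="\<lambda>a. (F2 a)\<^sup>2" and g="\<lambda>a. (G2 a)\<^sup>2"])
    finally show ?thesis .
  qed
  have "2 * ?L = (\<integral>\<^sup>+x. \<integral>\<^sup>+y. qker e y * (2 *
      ((F1 (fst (fst y)) * F2 (fst (snd y)) * G1 (snd (fst y) - x) * G2 (snd (snd y) - x)) *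
       (F1 (snd (fst y)) * F2 (snd (snd y)) * G1 (fst (fst y) - x) * G2 (fst (snd y) - x)))) \<partial>nu \<partial>nu)"
    by (subst nn_integral_cmult[symmetric], measurable, subst nn_integral_cmult[symmetric], measurable)
       (simp add: mult_ac)
  also have "\<dots> \<le> (\<integral>\<^sup>+x. \<integral>\<^sup>+y. T x y + T x ((snd (fst y), fst (fst y)), (snd (snd y), fst (snd y))) \<partial>nu \<partial>nu)"
  proof (intro nn_integral_mono)
    fix x :: 'a and y :: "('a \<times> 'a) \<times> ('a \<times> 'a)"
    \<comment> \<open>The exchange negates the argument of the even kernel.\<close>
    have "qker e ((snd (fst y), fst (fst y)), (snd (snd y), fst (snd y))) = qker e y"
      unfolding qker_def using gker_minus[of e "fst (fst y) + fst (snd y) - snd (fst y) - snd (snd y)"]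
      by (simp add: algebra_simps)
    then show "qker e y * (2 *
      ((F1 (fst (fst y)) * F2 (fst (snd y)) * G1 (snd (fst y) - x) * G2 (snd (snd y) - x)) *
       (F1 (snd (fst y)) * F2 (snd (snd y)) * G1 (fst (fst y) - x) * G2 (fst (snd y) - x))))
       \<le> T x y + T x ((snd (fst y), fst (fst y)), (snd (snd y), fst (snd y)))"
      unfolding T_def by (simp add: distrib_left[symmetric] mult_left_mono two_mult_le_ennreal)
  qed
  also have "\<dots> = (\<integral>\<^sup>+x. (\<integral>\<^sup>+y. T x y \<partial>nu) + (\<integral>\<^sup>+y. T x y \<partial>nu) \<partial>nu)"
    by (intro nn_integral_cong, subst nn_integral_add) (simp, simp add: T_def, simp only: swap)
  also have "\<dots> = 2 * ?R"
    by (subst nn_integral_add) (auto simp: main mult_2)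
  finally show ?thesis
    by (simp add: ennreal_mult_le_mult_iff)
qed

section \<open>Complex structures and their Fourier transforms\<close>

lemma integrable_gauss_bounded:
  fixes h :: "'a::euclidean_space \<Rightarrow> real"
  assumes e: "0 < e" and [measurable]: "h \<in> borel_measurable borel" and h: "\<And>w. \<bar>h w\<bar> \<le> B"
  shows "integrable nu (\<lambda>w. gauss (e *\<^sub>R w) * h w)"
proof (rule Bochner_Integration.integrable_bound)
  show "integrable nu (\<lambda>w::'a. B * gauss (e *\<^sub>R w))"
    by (intro integrable_mult_right gker_transform(1) e)
  show "AE w in nu. norm (gauss (e *\<^sub>R w) * h w) \<le> norm (B * gauss (e *\<^sub>R w))"
    using order.trans[OF h abs_ge_self[of B]] by (intro AE_I2) (simp add: abs_mult mult.commute mult_right_mono)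
qed simp

text \<open>Product-to-sum formulas leave cosines and sines of \<open>s1 + s2\<close> and
  \<open>s1 - s2\<close>; against the Gaussian weight the sines integrate to 0.\<close>

lemma gauss_trig_integral:
  fixes s1 s2 :: "'a::euclidean_space"
  assumes e: "0 < e"
  shows "(LINT w|nu. gauss (e *\<^sub>R w) *
      ((cos (s1 \<bullet> w) * u1 - sin (s1 \<bullet> w) * v1) * (cos (s2 \<bullet> w) * u2 - sin (s2 \<bullet> w) * v2))) =
    ((u1 * u2 - v1 * v2) * gker e (s1 + s2) + (u1 * u2 + v1 * v2) * gker e (s1 - s2)) / 2"
proof -
  have C: "integrable nu (\<lambda>w. gauss (e *\<^sub>R w) * cos (s \<bullet> w))"
    and S: "integrable nu (\<lambda>w. gauss (e *\<^sub>R w) * sin (s \<bullet> w))" for s :: 'a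
    by (rule integrable_gauss_bounded[where B=1]; simp add: e)+
  have "gauss (e *\<^sub>R w) *
      ((cos (s1 \<bullet> w) * u1 - sin (s1 \<bullet> w) * v1) * (cos (s2 \<bullet> w) * u2 - sin (s2 \<bullet> w) * v2)) =
    (u1 * u2 - v1 * v2) / 2 * (gauss (e *\<^sub>R w) * cos ((s1 + s2) \<bullet> w)) +
    (u1 * u2 + v1 * v2) / 2 * (gauss (e *\<^sub>R w) * cos ((s1 - s2) \<bullet> w)) +
    (- (u1 * v2 + v1 * u2) / 2 * (gauss (e *\<^sub>R w) * sin ((s1 + s2) \<bullet> w)) +
     (u1 * v2 - v1 * u2) / 2 * (gauss (e *\<^sub>R w) * sin ((s1 - s2) \<bullet> w)))" for w
    unfolding inner_add_left inner_diff_left cos_add cos_diff sin_add sin_diff by (simp add: field_simps)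
  then have "(LINT w|nu. gauss (e *\<^sub>R w) *
      ((cos (s1 \<bullet> w) * u1 - sin (s1 \<bullet> w) * v1) * (cos (s2 \<bullet> w) * u2 - sin (s2 \<bullet> w) * v2))) =
    (u1 * u2 - v1 * v2) / 2 * gker e (s1 + s2) + (u1 * u2 + v1 * v2) / 2 * gker e (s1 - s2) + 
    (- (u1 * v2 + v1 * u2) / 2 * 0 + (u1 * v2 - v1 * u2) / 2 * 0)"
    by (simp only: Bochner_Integration.integral_add integrable_mult_right Bochner_Integration.integrable_add
      C S integral_mult_right_zero gker_transform(2,3)[OF e])
  then show ?thesis
    by (simp add: field_simps)
qed

lemma gauss_trig_integral_le:
  fixes s1 s2 :: "'a::euclidean_space"
  assumes e: "0 < e" and r: "u1\<^sup>2 + v1\<^sup>2 \<le> r1\<^sup>2" "u2\<^sup>2 + v2\<^sup>2 \<le> r2\<^sup>2" "0 \<le> r1" "0 \<le> r2"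
  shows "(LINT w|nu. gauss (e *\<^sub>R w) *
      ((cos (s1 \<bullet> w) * u1 - sin (s1 \<bullet> w) * v1) * (cos (s2 \<bullet> w) * u2 - sin (s2 \<bullet> w) * v2)))
    \<le> r1 * r2 * ((gker e (s1 + s2) + gker e (s1 - s2)) / 2)"
proof -
  \<comment> \<open>Planar Cauchy-Schwarz by Lagrange's identity, for \<open>c = v1\<close> and
    \<open>c = - v1\<close> together: the coefficients of the two kernels differ in this
    sign.\<close>
  have CS: "u1 * u2 + c * v2 \<le> r1 * r2" if "c\<^sup>2 = v1\<^sup>2" for c
  proof (rule power2_le_imp_le)
    have "(u1 * u2 + c * v2)\<^sup>2 + (u1 * v2 - c * u2)\<^sup>2 = (u1\<^sup>2 + c\<^sup>2) * (u2\<^sup>2 + v2\<^sup>2)"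
      by algebra
    then have "(u1 * u2 + c * v2)\<^sup>2 \<le> (u1\<^sup>2 + v1\<^sup>2) * (u2\<^sup>2 + v2\<^sup>2)"
      by (metis add_increasing2 order_refl le_add_same_cancel1 zero_le_power2 that)
    also have "\<dots> \<le> r1\<^sup>2 * r2\<^sup>2"
      using r by (intro mult_mono) auto
    finally show "(u1 * u2 + c * v2)\<^sup>2 \<le> (r1 * r2)\<^sup>2"
      by (simp add: power_mult_distrib)
  qed (use r in auto)
  have "(u1 * u2 - v1 * v2) * gker e (s1 + s2) \<le> r1 * r2 * gker e (s1 + s2)"
    "(u1 * u2 + v1 * v2) * gker e (s1 - s2) \<le> r1 * r2 * gker e (s1 - s2)"
    using CS[of v1] CS[of "- v1"] e by (auto intro!: mult_right_mono gker_nonneg)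
  then show ?thesis
    unfolding gauss_trig_integral[OF e] by (simp add: field_simps)
qed

lemma gker_le: "0 < e \<Longrightarrow> gker e (s::'a::euclidean_space) \<le> 1 / e ^ DIM('a)"
  unfolding gker_def by (intro divide_right_mono gauss_le_1) auto

text \<open>Covers left multiplication by \<open>quat_i\<close> and right multiplication by
  \<open>quat_j\<close>, so that one estimate serves both the transform in \<open>t1\<close> and the
  transform in \<open>t2\<close>.\<close>

locale complex_structure =
  fixes J :: "'q::euclidean_space \<Rightarrow> 'q"
  assumes orth: "orthogonal_transformation J" and JJ: "J (J p) = - p"
begin

text \<open>The action of \<open>exp (- b J)\<close>, written out by Euler's formula.\<close>

definition rot :: "real \<Rightarrow> 'q \<Rightarrow> 'q" where
  "rot b p = cos b *\<^sub>R p - sin b *\<^sub>R J p"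

definition trans :: "('a::euclidean_space \<Rightarrow> 'q) \<Rightarrow> 'a \<Rightarrow> 'q" where
  "trans \<phi> w = (LINT t|nu. rot (t \<bullet> w) (\<phi> t))"

lemma linear_J: "linear J"
  using orth by (rule orthogonal_transformation_linear)

lemma inner_J_J: "J p \<bullet> J q = p \<bullet> q"
  using orth by (simp add: orthogonal_transformation_def)

lemma inner_J_right: "p \<bullet> J q = - (J p \<bullet> q)"
  using inner_J_J[of p "J q"] by (simp add: JJ)

lemma norm_J [simp]: "norm (J p) = norm p"
  by (simp add: norm_eq_sqrt_inner inner_J_J)

lemma inner_rot_rot: "rot b p \<bullet> rot c q = cos (b - c) * (p \<bullet> q) - sin (b - c) * (J p \<bullet> q)"
proof -
  have "rot b p \<bullet> rot c q = cos b * cos c * (p \<bullet> q) + sin b * sin c * (J p \<bullet> J q)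
      - cos b * sin c * (p \<bullet> J q) - sin b * cos c * (J p \<bullet> q)"
    by (simp add: rot_def inner_diff_left inner_diff_right algebra_simps)
  then show ?thesis
    by (simp add: inner_J_J inner_J_right[of p q] cos_diff sin_diff algebra_simps)
qed

lemma norm_rot [simp]: "norm (rot b p) = norm p"
  by (simp add: norm_eq_sqrt_inner inner_rot_rot)

text \<open>\<open>p\<close> and \<open>J p\<close> are orthogonal and of equal norm, so this is
  Bessel's inequality for \<open>q\<close>. It bounds both coefficients of \<open>corr\<close>
  jointly; two separate Cauchy-Schwarz bounds would lose a factor 2.\<close>

lemma bessel: "(p \<bullet> q)\<^sup>2 + (J p \<bullet> q)\<^sup>2 \<le> (norm p * norm q)\<^sup>2"
proof -
  \<comment> \<open>\<open>v\<close> is the projection of \<open>q\<close> to the span of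
    \<open>p\<close> and \<open>J p\<close>, scaled by the squared norm of \<open>p\<close>.
    Cauchy-Schwarz for \<open>v\<close> and \<open>q\<close> yields an inequality from which one
    factor \<open>X\<close> cancels.\<close>
  define v where "v = (p \<bullet> q) *\<^sub>R p + (J p \<bullet> q) *\<^sub>R J p"
  define X where "X = (p \<bullet> q)\<^sup>2 + (J p \<bullet> q)\<^sup>2"
  have "J p \<bullet> p = 0"
    using inner_J_right[of p p] by (simp add: inner_commute)
  then have "v \<bullet> v = X * (norm p)\<^sup>2"
    by (simp add: v_def X_def inner_add_left inner_add_right inner_commute[of p "J p"] inner_J_J
        power2_norm_eq_inner) (simp add: algebra_simps power2_eq_square)
  moreover have "v \<bullet> q = X"
    by (simp add: v_def X_def inner_add_left power2_eq_square)
  ultimately have "X\<^sup>2 \<le> X * (norm p * norm q)\<^sup>2"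
    using Cauchy_Schwarz_ineq[of v q]
    by (simp add: power2_norm_eq_inner[symmetric] power_mult_distrib mult.assoc)
  moreover have "0 \<le> X"
    by (simp add: X_def)
  ultimately show ?thesis
    unfolding X_def[symmetric] by (cases "X = 0") (auto simp: power2_eq_square)
qed

lemma borel_measurable_rot [measurable (raw)]:
  assumes [measurable]: "f \<in> borel_measurable M" "g \<in> borel_measurable M"
  shows "(\<lambda>x. rot (f x) (g x)) \<in> borel_measurable M"
proof -
  have [measurable]: "J \<in> borel_measurable borel"
    using linear_J by (intro borel_measurable_continuous_onI linear_continuous_on linear_conv_bounded_linear[THEN iffD1])
  show ?thesis
    unfolding rot_def by measurable
qed

lemma integrable_rot_iff:
  assumes [measurable]: "\<phi> \<in> borel_measurable borel"
  shows "integrable nu (\<lambda>t. rot (t \<bullet> w) (\<phi> t)) \<longleftrightarrow> integrable nu \<phi>"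
  by (simp add: integrable_iff_bounded)

text \<open>The integrand of the double integral for \<open>(norm (trans \<phi> w))\<^sup>2\<close>,
  expanded so that \<open>w\<close> enters through one cosine and one sine, as in
  \<open>gauss_trig_integral\<close>.\<close>

definition corr :: "('a::euclidean_space \<Rightarrow> 'q) \<Rightarrow> 'a \<times> 'a \<Rightarrow> 'a \<Rightarrow> real" where
  "corr \<phi> z w = cos ((fst z - snd z) \<bullet> w) * (\<phi> (fst z) \<bullet> \<phi> (snd z)) -
     sin ((fst z - snd z) \<bullet> w) * (J (\<phi> (fst z)) \<bullet> \<phi> (snd z))"

lemma corr_eq: "corr \<phi> z w = rot (fst z \<bullet> w) (\<phi> (fst z)) \<bullet> rot (snd z \<bullet> w) (\<phi> (snd z))"
  by (simp add: corr_def inner_rot_rot inner_diff_left)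

lemma corr_bound: "\<bar>corr \<phi> z w\<bar> \<le> norm (\<phi> (fst z)) * norm (\<phi> (snd z))"
  unfolding corr_eq using Cauchy_Schwarz_ineq2 by (rule order.trans) simp

lemma norm_trans_squared:
  assumes "integrable nu \<phi>"
  shows "integrable nu (\<lambda>z. corr \<phi> z w)" "(norm (trans \<phi> w))\<^sup>2 = (LINT z|nu. corr \<phi> z w)"
proof -
  have [measurable]: "\<phi> \<in> borel_measurable borel"
    using assms by (auto dest: borel_measurable_integrable)
  have "integrable nu (\<lambda>t. rot (t \<bullet> w) (\<phi> t))"
    using assms by (simp add: integrable_rot_iff)
  from norm_integral_squared[OF this]
  show "integrable nu (\<lambda>z. corr \<phi> z w)" "(norm (trans \<phi> w))\<^sup>2 = (LINT z|nu. corr \<phi> z w)"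
    by (simp_all add: corr_eq trans_def)
qed

text \<open>The Bochner integral of a non-integrable function is 0 by convention, and rotations do
  not affect integrability.\<close>

lemma trans_eq_0:
  assumes [measurable]: "\<phi> \<in> borel_measurable borel" and "\<not> integrable nu \<phi>"
  shows "trans \<phi> w = 0"
  using assms by (simp add: trans_def not_integrable_integral_eq integrable_rot_iff)

text \<open>Each squared transform is a double integral, so four points and \<open>w\<close> are
  integrated in all. The weight makes this absolutely convergent, and Fubini moves the integral over
  \<open>w\<close> inside.\<close>

lemma integral_gauss_trans_trans:
  fixes \<phi>1 \<phi>2 :: "'a::euclidean_space \<Rightarrow> 'q"
  assumes int: "integrable nu \<phi>1" "integrable nu \<phi>2" and e: "0 < e"
  shows "(\<integral>\<^sup>+w. ennreal (gauss (e *\<^sub>R w) * ((norm (trans \<phi>1 w))\<^sup>2 * (norm (trans \<phi>2 w))\<^sup>2)) \<partial>nu) =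
    ennreal (LINT y|nu. LINT w|nu. gauss (e *\<^sub>R w) * (corr \<phi>1 (fst y) w * corr \<phi>2 (snd y) w))"
proof -
  have [measurable]: "\<phi>1 \<in> borel_measurable borel" "\<phi>2 \<in> borel_measurable borel"
    using int by (auto dest: borel_measurable_integrable)
  have [measurable]: "J \<in> borel_measurable borel"
    using linear_J by (intro borel_measurable_continuous_onI linear_continuous_on linear_conv_bounded_linear[THEN iffD1])
  define r where "r y = norm (\<phi>1 (fst (fst y))) * norm (\<phi>1 (snd (fst y))) *
    (norm (\<phi>2 (fst (snd y))) * norm (\<phi>2 (snd (snd y))))" for y
  have r: "integrable nu r"
    unfolding r_def
    by (intro integrable_nu_times[where f="\<lambda>z. norm (\<phi>1 (fst z)) * norm (\<phi>1 (snd z))"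
          and g="\<lambda>z. norm (\<phi>2 (fst z)) * norm (\<phi>2 (snd z))"]
        integrable_nu_times integrable_norm int)
  define K where "K v = gauss (e *\<^sub>R snd v) * (corr \<phi>1 (fst (fst v)) (snd v) * corr \<phi>2 (snd (fst v)) (snd v))" for v
  have K: "integrable nu K"
  proof (rule Bochner_Integration.integrable_bound)
    show "integrable nu (\<lambda>v :: (('a \<times> 'a) \<times> 'a \<times> 'a) \<times> 'a. r (fst v) * gauss (e *\<^sub>R snd v))"
      by (intro integrable_nu_times r gker_transform e)
    show "K \<in> borel_measurable nu"
      unfolding K_def corr_def by measurable
    have "\<bar>corr \<phi>1 u w * corr \<phi>2 v w\<bar> \<le> r (u, v)" for u v w
      unfolding abs_mult r_def fst_conv snd_conv by (intro mult_mono corr_bound) auto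
    then show "AE v in nu. norm (K v) \<le> norm (r (fst v) * gauss (e *\<^sub>R snd v))"
      by (intro AE_I2) (auto simp: K_def abs_mult r_def mult_ac intro!: mult_left_mono)
  qed
  have prod: "(norm (trans \<phi>1 w))\<^sup>2 * (norm (trans \<phi>2 w))\<^sup>2 = (LINT y|nu. corr \<phi>1 (fst y) w * corr \<phi>2 (snd y) w)" for w
  proof -
    have I: "integrable nu (\<lambda>y. corr \<phi>1 (fst y) w * corr \<phi>2 (snd y) w)"
      by (intro integrable_nu_times norm_trans_squared int)
    show ?thesis
      unfolding integral_nu_pair(1)[OF I] by (simp add: norm_trans_squared int)
  qed
  have eq: "gauss (e *\<^sub>R w) * ((norm (trans \<phi>1 w))\<^sup>2 * (norm (trans \<phi>2 w))\<^sup>2) = (LINT y|nu. K (y, w))" for w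
    by (simp add: prod K_def)
  have "(\<integral>\<^sup>+w. ennreal (gauss (e *\<^sub>R w) * ((norm (trans \<phi>1 w))\<^sup>2 * (norm (trans \<phi>2 w))\<^sup>2)) \<partial>nu) =
      ennreal (LINT w|nu. LINT y|nu. K (y, w))"
    using integral_nu_pair(4)[OF K] unfolding eq[symmetric]
    by (intro nn_integral_eq_integral) auto
  also have "\<dots> = ennreal (LINT y|nu. LINT w|nu. K (y, w))"
    using integral_nu_pair(1,2)[OF K] by simp
  finally show ?thesis
    by (simp add: K_def)
qed

text \<open>At four fixed points the integral over \<open>w\<close> is at most the product of the
  norms times the mean of the kernels at \<open>(a1 - a3) + (a2 - a4)\<close> and
  \<open>(a1 - a3) - (a2 - a4)\<close>. Exchanging \<open>a2\<close> and \<open>a4\<close> carries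
  the second kernel into the first, so a single kernel remains without loss.\<close>

lemma nn_integral_gauss_trans_trans_le:
  fixes \<phi>1 \<phi>2 :: "'a::euclidean_space \<Rightarrow> 'q"
  assumes [measurable]: "\<phi>1 \<in> borel_measurable borel" "\<phi>2 \<in> borel_measurable borel" and e: "0 < e"
  shows "(\<integral>\<^sup>+w. ennreal (gauss (e *\<^sub>R w) * ((norm (trans \<phi>1 w))\<^sup>2 * (norm (trans \<phi>2 w))\<^sup>2)) \<partial>nu) \<le>
    (\<integral>\<^sup>+y. qker e y * (ennreal (norm (\<phi>1 (fst (fst y)))) * ennreal (norm (\<phi>1 (snd (fst y)))) *
       (ennreal (norm (\<phi>2 (fst (snd y)))) * ennreal (norm (\<phi>2 (snd (snd y)))))) \<partial>nu)"
proof (cases "integrable nu \<phi>1 \<and> integrable nu \<phi>2")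
  case False
  then show ?thesis
    by (auto simp: trans_eq_0)
next
  case True
  define r where "r y = norm (\<phi>1 (fst (fst y))) * norm (\<phi>1 (snd (fst y))) *
    (norm (\<phi>2 (fst (snd y))) * norm (\<phi>2 (snd (snd y))))" for y :: "('a \<times> 'a) \<times> 'a \<times> 'a"
  define p where "p y = gker e ((fst (fst y) - snd (fst y)) + (fst (snd y) - snd (snd y)))"
    for y :: "('a \<times> 'a) \<times> 'a \<times> 'a"
  define q where "q y = gker e ((fst (fst y) - snd (fst y)) - (fst (snd y) - snd (snd y)))"
    for y :: "('a \<times> 'a) \<times> 'a \<times> 'a"
  have [measurable]: "r \<in> borel_measurable borel" "p \<in> borel_measurable borel" "q \<in> borel_measurable borel"
    unfolding r_def p_def q_def by measurable
  have r: "integrable nu r"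
    unfolding r_def
    by (intro integrable_nu_times[where f="\<lambda>z. norm (\<phi>1 (fst z)) * norm (\<phi>1 (snd z))"
          and g="\<lambda>z. norm (\<phi>2 (fst z)) * norm (\<phi>2 (snd z))"]
        integrable_nu_times integrable_norm) (use True in auto)
  have nonneg: "0 \<le> r y" "0 \<le> p y" "0 \<le> q y" for y
    using e by (auto simp: r_def p_def q_def intro!: gker_nonneg)
  have R: "integrable nu (\<lambda>y. r y * ((p y + q y) / 2))"
  proof (rule Bochner_Integration.integrable_bound)
    show "integrable nu (\<lambda>y. r y * (1 / e ^ DIM('a)))"
      by (intro integrable_mult_left r)
    have "(p y + q y) / 2 \<le> 1 / e ^ DIM('a)" for y
    proof -
      have "p y \<le> 1 / e ^ DIM('a)" "q y \<le> 1 / e ^ DIM('a)"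
        unfolding p_def q_def by (rule gker_le[OF e])+
      then have "p y + q y \<le> 2 * (1 / e ^ DIM('a))"
        by (metis add_mono mult_2)
      then show ?thesis
        by simp
    qed
    then have "r y * ((p y + q y) / 2) \<le> r y * (1 / e ^ DIM('a))" for y
      by (intro mult_left_mono nonneg)
    moreover have "norm (r y * ((p y + q y) / 2)) = r y * ((p y + q y) / 2)" for y
      using nonneg[of y] by simp
    ultimately show "AE y in nu. norm (r y * ((p y + q y) / 2)) \<le> norm (r y * (1 / e ^ DIM('a)))"
      by (metis (no_types, lifting) AE_I2 abs_ge_self order.trans real_norm_def)
  qed simp
  have "(\<integral>\<^sup>+w. ennreal (gauss (e *\<^sub>R w) * ((norm (trans \<phi>1 w))\<^sup>2 * (norm (trans \<phi>2 w))\<^sup>2)) \<partial>nu) =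
    ennreal (LINT y|nu. LINT w|nu. gauss (e *\<^sub>R w) * (corr \<phi>1 (fst y) w * corr \<phi>2 (snd y) w))"
    using True e by (simp add: integral_gauss_trans_trans)
  \<comment> \<open>Besides the pointwise inequality, which rests on \<open>bessel\<close>,
    \<open>integral_mono_AE'\<close> asks that the upper bound be integrable and
    nonnegative.\<close>
  also have "\<dots> \<le> ennreal (LINT y|nu. r y * ((p y + q y) / 2))"
  proof (intro ennreal_leI integral_mono_AE' R AE_I2)
    fix y :: "('a \<times> 'a) \<times> 'a \<times> 'a"
    show "(LINT w|nu. gauss (e *\<^sub>R w) * (corr \<phi>1 (fst y) w * corr \<phi>2 (snd y) w)) \<le> r y * ((p y + q y) / 2)"
      unfolding corr_def r_def p_def q_def by (intro gauss_trig_integral_le e bessel) auto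
    show "0 \<le> r y * ((p y + q y) / 2)"
      using nonneg by simp
  qed
  also have "\<dots> = (\<integral>\<^sup>+y. ennreal (r y * ((p y + q y) / 2)) \<partial>nu)"
    using nonneg R by (intro nn_integral_eq_integral[symmetric]) auto
  also have "\<dots> = (\<integral>\<^sup>+y. ennreal (1/2) * (ennreal (r y * p y) + ennreal (r y * q y)) \<partial>nu)"
  proof (intro nn_integral_cong)
    fix y :: "('a \<times> 'a) \<times> 'a \<times> 'a"
    have pos: "0 \<le> r y * p y" "0 \<le> r y * q y"
      using nonneg by auto
    show "ennreal (r y * ((p y + q y) / 2)) = ennreal (1/2) * (ennreal (r y * p y) + ennreal (r y * q y))"
      unfolding ennreal_plus[OF pos, symmetric] using pos
      by (subst ennreal_mult[symmetric]) (auto simp: distrib_left add_divide_distrib intro!: arg_cong[where f=ennreal])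
  qed
  also have "\<dots> = ennreal (1/2) * ((\<integral>\<^sup>+y. ennreal (r y * p y) \<partial>nu) + (\<integral>\<^sup>+y. ennreal (r y * q y) \<partial>nu))"
    by (simp add: nn_integral_cmult nn_integral_add)
  also have "(\<integral>\<^sup>+y. ennreal (r y * q y) \<partial>nu) = (\<integral>\<^sup>+u. \<integral>\<^sup>+v. ennreal (r (u, v) * q (u, v)) \<partial>nu \<partial>nu)"
    by (rule nn_integral_nu_pair) simp
  \<comment> \<open>Exchanging the points of the second pair turns \<open>q\<close> into
    \<open>p\<close> and leaves \<open>r\<close> unchanged.\<close>
  also have "\<dots> = (\<integral>\<^sup>+u. \<integral>\<^sup>+v. ennreal (r (u, (snd v, fst v)) * q (u, (snd v, fst v))) \<partial>nu \<partial>nu)"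
    by (intro nn_integral_cong nn_integral_nu_swap[where f="\<lambda>v. ennreal (r (u, v) * q (u, v))" for u, symmetric]) simp
  also have "\<dots> = (\<integral>\<^sup>+u. \<integral>\<^sup>+v. ennreal (r (u, v) * p (u, v)) \<partial>nu \<partial>nu)"
    by (simp add: r_def p_def q_def algebra_simps)
  also have "\<dots> = (\<integral>\<^sup>+y. ennreal (r y * p y) \<partial>nu)"
    by (rule nn_integral_nu_pair[symmetric]) simp
  also have "ennreal (1/2) * ((\<integral>\<^sup>+y. ennreal (r y * p y) \<partial>nu) + (\<integral>\<^sup>+y. ennreal (r y * p y) \<partial>nu)) =
      (\<integral>\<^sup>+y. ennreal (r y * p y) \<partial>nu)"
  proof -
    have "ennreal (1/2) * 2 = 1"
      using ennreal_mult[of "1/2" 2] by simp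
    then show ?thesis
      unfolding mult_2[symmetric] mult.assoc[symmetric] by simp
  qed
  also have "\<dots> = (\<integral>\<^sup>+y. qker e y * (ennreal (norm (\<phi>1 (fst (fst y)))) * ennreal (norm (\<phi>1 (snd (fst y)))) *
       (ennreal (norm (\<phi>2 (fst (snd y)))) * ennreal (norm (\<phi>2 (snd (snd y)))))) \<partial>nu)"
    using nonneg by (intro nn_integral_cong)
      (simp add: r_def p_def qker_def ennreal_mult algebra_simps)
  finally show ?thesis .
qed

end

section \<open>The fourth power of the quaternion Fourier transform\<close>

lemma (in complex_structure) borel_measurable_trans [measurable (raw)]:
  fixes \<phi> :: "'c \<Rightarrow> 'a::euclidean_space \<Rightarrow> 'q"
  assumes [measurable]: "case_prod \<phi> \<in> borel_measurable (M \<Otimes>\<^sub>M borel)" "k \<in> borel_measurable M"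
  shows "(\<lambda>v. trans (\<phi> v) (k v)) \<in> borel_measurable M"
  unfolding trans_def by measurable

section \<open>Left and right rotations and the two-sided transform\<close>

interpretation left: complex_structure "\<lambda>p. quat_i * p"
proof
  show "orthogonal_transformation (\<lambda>p. quat_i * p)"
    unfolding orthogonal_transformation norm_quat_mult
    by (auto simp: quat_i_def norm_quat_def inner_quat_def intro!: linearI distrib_left)
qed (simp add: mult.assoc[symmetric] quat_units)

interpretation right: complex_structure "\<lambda>p. p * quat_j"
proof
  show "orthogonal_transformation (\<lambda>p. p * quat_j)"
    unfolding orthogonal_transformation norm_quat_mult
    by (auto simp: quat_j_def norm_quat_def inner_quat_def intro!: linearI distrib_right)
qed (simp add: mult.assoc quat_units)

lemma left_rot_eq: "left.rot b p = exp (- (b *\<^sub>R quat_i)) * p"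
  using exp_scaleR_imaginary_unit[OF quat_units(1), of "-b"]
  by (simp add: left.rot_def left_diff_distrib)

lemma right_rot_eq: "right.rot b p = p * exp (- (b *\<^sub>R quat_j))"
  using exp_scaleR_imaginary_unit[OF quat_units(2), of "-b"]
  by (simp add: right.rot_def right_diff_distrib)

lemma borel_measurable_qcnj [measurable]: "qcnj \<in> borel_measurable borel"
proof -
  have "bounded_linear qcnj"
    by (intro linear_conv_bounded_linear[THEN iffD1] linearI) (auto simp: quat_eq_iff)
  then show ?thesis
    by (intro borel_measurable_continuous_onI linear_continuous_on)
qed

text \<open>An iterated integral, so that the one-variable estimates apply to each transform in
  turn; for integrable \<open>h\<close> it is the integral over the product by
  \<open>qft_eq_integral\<close>.\<close>

definition qft :: "('a::euclidean_space \<times> 'a \<Rightarrow> quat) \<Rightarrow> 'a \<times> 'a \<Rightarrow> quat" where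
  "qft h w = left.trans (\<lambda>a. right.trans (\<lambda>b. h (a, b)) (snd w)) (fst w)"

text \<open>The product inside \<open>ambiguity\<close> after a shift of \<open>t\<close> by half of
  \<open>x\<close>; \<open>norm_ambiguity\<close> shows that the shift preserves the norm of the
  transform.\<close>

definition hprod :: "('a::euclidean_space \<Rightarrow> quat) \<Rightarrow> ('a \<Rightarrow> quat) \<Rightarrow> 'a \<Rightarrow> 'a \<Rightarrow> quat" where
  "hprod f g x t = f t * qcnj (g (t - x))"

lemma norm_hprod: "ennreal (norm (hprod f g x t)) = ennreal (norm (f t)) * ennreal (norm (g (t - x)))"
  by (simp add: hprod_def norm_quat_mult ennreal_mult)

lemma borel_measurable_hprod [measurable (raw)]:
  assumes [measurable]: "f \<in> borel_measurable borel" "g \<in> borel_measurable borel"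
    "x \<in> borel_measurable M" "t \<in> borel_measurable M"
  shows "(\<lambda>v. hprod f g (x v) (t v)) \<in> borel_measurable M"
  unfolding hprod_def by measurable

lemma borel_measurable_qft [measurable (raw)]:
  assumes [measurable]: "case_prod h \<in> borel_measurable (M \<Otimes>\<^sub>M borel)" "w \<in> borel_measurable M"
  shows "(\<lambda>v. qft (h v) (w v)) \<in> borel_measurable M"
  unfolding qft_def by measurable

text \<open>Passes from bounds for squares to a bound for mixed products with the same constant
  \<open>c\<close>.\<close>

lemma nn_integral_le_of_Cauchy_Schwarz:
  fixes X Y :: "'a \<Rightarrow> ennreal"
  assumes [measurable]: "X \<in> borel_measurable M" "Y \<in> borel_measurable M"
    and "(\<integral>\<^sup>+u. (X u)\<^sup>2 \<partial>M) \<le> c * a\<^sup>2" "(\<integral>\<^sup>+u. (Y u)\<^sup>2 \<partial>M) \<le> c * b\<^sup>2"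
  shows "(\<integral>\<^sup>+u. X u * Y u \<partial>M) \<le> c * (a * b)"
proof -
  have "(\<integral>\<^sup>+u. X u * Y u \<partial>M)\<^sup>2 \<le> (c * a\<^sup>2) * (c * b\<^sup>2)"
    using Cauchy_Schwarz_nn_integral[OF assms(1,2)] mult_mono[OF assms(3,4)] by (rule order.trans) auto
  also have "\<dots> = (c * (a * b))\<^sup>2"
    by (simp add: power2_eq_square mult_ac)
  finally show ?thesis
    by (simp add: ennreal_power2_le_iff)
qed

text \<open>The transforms in \<open>t1\<close> and in \<open>t2\<close> are estimated one after the other: a simultaneous
  four-fold expansion of \<open>|qft h|^4\<close> loses a constant, since it mixes the two imaginary units.\<close>

lemma qft_hprod_fourth_power_bound:
  fixes f g :: "'a::euclidean_space \<times> 'a \<Rightarrow> quat"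
  assumes [measurable]: "f \<in> borel_measurable borel" "g \<in> borel_measurable borel" and e: "0 < e"
  shows "(\<integral>\<^sup>+x. \<integral>\<^sup>+w. ennreal (gauss (e *\<^sub>R w) * norm (qft (hprod f g x) w) ^ 4) \<partial>nu \<partial>nu) \<le>
    ennreal (1 / 2 ^ (2 * DIM('a))) *
      ((\<integral>\<^sup>+t. ennreal (norm (f t)) ^ 2 \<partial>nu) * (\<integral>\<^sup>+t. ennreal (norm (g t)) ^ 2 \<partial>nu))\<^sup>2"
proof -
  \<comment> \<open>\<open>N x1 u a\<close> is the norm of the partial transform in
    \<open>t2\<close> with \<open>u = (x2, w2)\<close>; \<open>F\<close> and \<open>G\<close> below
    are the \<open>L^2\<close> norms of slices of \<open>f\<close> and \<open>g\<close>.\<close>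
  define N where "N x1 u a = ennreal (norm (right.trans (\<lambda>b. hprod f g (x1, fst u) (a, b)) (snd u)))" for x1 u a
  define c where "c = ennreal (1 / 2 ^ DIM('a))"
  define F where "F a = esqrt (\<integral>\<^sup>+b. ennreal (norm (f (a, b))) ^ 2 \<partial>nu)" for a
  define G where "G a = esqrt (\<integral>\<^sup>+b. ennreal (norm (g (a, b))) ^ 2 \<partial>nu)" for a
  have N_measurable [measurable (raw)]:
    "(\<lambda>v. N (p v) (q v) (r v)) \<in> borel_measurable M"
    if [measurable]: "p \<in> borel_measurable M" "q \<in> borel_measurable M" "r \<in> borel_measurable M"
    for p q r and M :: "'m measure"
    unfolding N_def by measurable
  have [measurable]: "F \<in> borel_measurable borel" "G \<in> borel_measurable borel"
    unfolding F_def G_def by measurable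
  \<comment> \<open>The transform in \<open>t1\<close>: the same function is taken for
    \<open>\<phi>1\<close> and \<open>\<phi>2\<close>, which makes the product of squares a fourth
    power.\<close>
  have step1: "(\<integral>\<^sup>+w1. ennreal (gauss (e *\<^sub>R w1) * norm (qft (hprod f g (x1, x2)) (w1, w2)) ^ 4) \<partial>nu) \<le>
      (\<integral>\<^sup>+y. qker e y * (N x1 (x2, w2) (fst (fst y)) * N x1 (x2, w2) (snd (fst y)) *
         (N x1 (x2, w2) (fst (snd y)) * N x1 (x2, w2) (snd (snd y)))) \<partial>nu)" for x1 x2 w2
  proof -
    define \<phi> where "\<phi> a = right.trans (\<lambda>b. hprod f g (x1, x2) (a, b)) w2" for a
    have [measurable]: "\<phi> \<in> borel_measurable borel"
      unfolding \<phi>_def by measurable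
    show ?thesis
      using left.nn_integral_gauss_trans_trans_le[of \<phi> \<phi>, OF _ _ e]
      by (simp add: qft_def N_def \<phi>_def[symmetric] power2_eq_square numeral_eq_Suc mult.assoc)
  qed
  \<comment> \<open>The transform in \<open>t2\<close> for the slices at \<open>a\<close> and
    \<open>a'\<close>, then the convolution bound in \<open>x2\<close>, whose four functions are the
    slices of \<open>f\<close> and \<open>g\<close>. This yields the first factor
    \<open>c\<close>.\<close>
  have step2: "(\<integral>\<^sup>+u. ennreal (gauss (e *\<^sub>R snd u)) * (N x1 u a * N x1 u a')\<^sup>2 \<partial>nu) \<le>
      c * (F a * G (a - x1) * (F a' * G (a' - x1)))\<^sup>2" for x1 a a'
  proof -
    have "(\<integral>\<^sup>+u. ennreal (gauss (e *\<^sub>R snd u)) * (N x1 u a * N x1 u a')\<^sup>2 \<partial>nu) =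
        (\<integral>\<^sup>+x2. \<integral>\<^sup>+w2. ennreal (gauss (e *\<^sub>R w2)) * (N x1 (x2, w2) a * N x1 (x2, w2) a')\<^sup>2 \<partial>nu \<partial>nu)"
      by (subst nn_integral_nu_pair) auto
    also have "\<dots> \<le> (\<integral>\<^sup>+x2. \<integral>\<^sup>+y. qker e y *
      (ennreal (norm (f (a, fst (fst y)))) * ennreal (norm (g (a - x1, fst (fst y) - x2))) *
       (ennreal (norm (f (a, snd (fst y)))) * ennreal (norm (g (a - x1, snd (fst y) - x2)))) *
       (ennreal (norm (f (a', fst (snd y)))) * ennreal (norm (g (a' - x1, fst (snd y) - x2))) *
       (ennreal (norm (f (a', snd (snd y)))) * ennreal (norm (g (a' - x1, snd (snd y) - x2)))))) \<partial>nu \<partial>nu)"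
    proof (intro nn_integral_mono)
      fix x2 :: 'a
      show "(\<integral>\<^sup>+w2. ennreal (gauss (e *\<^sub>R w2)) * (N x1 (x2, w2) a * N x1 (x2, w2) a')\<^sup>2 \<partial>nu) \<le>
       (\<integral>\<^sup>+y. qker e y *
      (ennreal (norm (f (a, fst (fst y)))) * ennreal (norm (g (a - x1, fst (fst y) - x2))) *
       (ennreal (norm (f (a, snd (fst y)))) * ennreal (norm (g (a - x1, snd (fst y) - x2)))) *
       (ennreal (norm (f (a', fst (snd y)))) * ennreal (norm (g (a' - x1, fst (snd y) - x2))) *
       (ennreal (norm (f (a', snd (snd y)))) * ennreal (norm (g (a' - x1, snd (snd y) - x2)))))) \<partial>nu)"
        using right.nn_integral_gauss_trans_trans_le[of "\<lambda>b. hprod f g (x1, x2) (a, b)"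
            "\<lambda>b. hprod f g (x1, x2) (a', b)", OF _ _ e]
        by (simp add: N_def norm_hprod ennreal_mult ennreal_power power_mult_distrib)
    qed
    also have "\<dots> \<le> c * ((F a)\<^sup>2 * (G (a - x1))\<^sup>2 * ((F a')\<^sup>2 * (G (a' - x1))\<^sup>2))"
      unfolding c_def F_def G_def esqrt_power2
      by (rule gaussian_convolution_bound[OF _ _ _ _ e, of "\<lambda>b. ennreal (norm (f (a, b)))" "\<lambda>b. ennreal (norm (f (a', b)))"
        "\<lambda>b. ennreal (norm (g (a - x1, b)))" "\<lambda>b. ennreal (norm (g (a' - x1, b)))"]; measurable)
    finally show ?thesis
      by (simp add: power_mult_distrib)
  qed
  have step3: "(\<integral>\<^sup>+u. ennreal (gauss (e *\<^sub>R snd u)) * (N x1 u a1 * N x1 u a3 * (N x1 u a2 * N x1 u a4)) \<partial>nu) \<le>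
      c * (F a1 * G (a1 - x1) * (F a3 * G (a3 - x1)) * (F a2 * G (a2 - x1) * (F a4 * G (a4 - x1))))"
    for x1 a1 a2 a3 a4
  proof -
    \<comment> \<open>Cauchy-Schwarz in \<open>u\<close>, with the pairs \<open>a1, a3\<close> and
      \<open>a2, a4\<close>; each of the two factors receives the square root of the weight.\<close>
    define s where "s u = esqrt (ennreal (gauss (e *\<^sub>R snd u)))" for u :: "'a \<times> 'a"
    have [measurable]: "s \<in> borel_measurable borel"
      unfolding s_def by measurable
    have s2: "ennreal (gauss (e *\<^sub>R snd u)) = s u * s u" for u
      by (simp add: s_def power2_eq_square[symmetric])
    have s_bound: "(\<integral>\<^sup>+u. (s u * (N x1 u a * N x1 u a'))\<^sup>2 \<partial>nu) \<le> c * (F a * G (a - x1) * (F a' * G (a' - x1)))\<^sup>2" for a a'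
      using step2[of x1 a a'] by (simp add: s2 power2_eq_square mult_ac)
    have "(\<integral>\<^sup>+u. ennreal (gauss (e *\<^sub>R snd u)) * (N x1 u a1 * N x1 u a3 * (N x1 u a2 * N x1 u a4)) \<partial>nu) =
      (\<integral>\<^sup>+u. (s u * (N x1 u a1 * N x1 u a3)) * (s u * (N x1 u a2 * N x1 u a4)) \<partial>nu)"
      by (simp add: s2 mult_ac)
    also have "\<dots> \<le> c * ((F a1 * G (a1 - x1) * (F a3 * G (a3 - x1))) * (F a2 * G (a2 - x1) * (F a4 * G (a4 - x1))))"
      by (intro nn_integral_le_of_Cauchy_Schwarz s_bound) measurable
    finally show ?thesis .
  qed
  \<comment> \<open>The weight factors over \<open>w1\<close> and \<open>w2\<close>; the integral
    over \<open>w1\<close> is put innermost to match \<open>step1\<close>.\<close>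
  have "(\<integral>\<^sup>+x. \<integral>\<^sup>+w. ennreal (gauss (e *\<^sub>R w) * norm (qft (hprod f g x) w) ^ 4) \<partial>nu \<partial>nu) =
    (\<integral>\<^sup>+x1. \<integral>\<^sup>+x2. \<integral>\<^sup>+w2. ennreal (gauss (e *\<^sub>R w2)) *
      (\<integral>\<^sup>+w1. ennreal (gauss (e *\<^sub>R w1) * norm (qft (hprod f g (x1, x2)) (w1, w2)) ^ 4) \<partial>nu) \<partial>nu \<partial>nu \<partial>nu)"
  proof -
    have "(\<integral>\<^sup>+w. ennreal (gauss (e *\<^sub>R w) * norm (qft (hprod f g x) w) ^ 4) \<partial>nu) =
      (\<integral>\<^sup>+w2. ennreal (gauss (e *\<^sub>R w2)) *
      (\<integral>\<^sup>+w1. ennreal (gauss (e *\<^sub>R w1) * norm (qft (hprod f g x) (w1, w2)) ^ 4) \<partial>nu) \<partial>nu)" for x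
      by (simp add: nn_integral_nu_pair gauss_Pair, subst nn_integral_nu_Fubini)
         (auto simp: case_prod_beta ennreal_mult mult_ac nn_integral_cmult[symmetric] intro!: nn_integral_cong)
    then show ?thesis
      by (simp only:) (rule nn_integral_nu_pair, measurable)
  qed
  also have "\<dots> \<le> (\<integral>\<^sup>+x1. \<integral>\<^sup>+x2. \<integral>\<^sup>+w2. ennreal (gauss (e *\<^sub>R w2)) *
      (\<integral>\<^sup>+y. qker e y * (N x1 (x2, w2) (fst (fst y)) * N x1 (x2, w2) (snd (fst y)) *
         (N x1 (x2, w2) (fst (snd y)) * N x1 (x2, w2) (snd (snd y)))) \<partial>nu) \<partial>nu \<partial>nu \<partial>nu)"
    by (intro nn_integral_mono mult_left_mono step1) auto
  also have "\<dots> = (\<integral>\<^sup>+x1. \<integral>\<^sup>+u. \<integral>\<^sup>+y. qker e y * (ennreal (gauss (e *\<^sub>R snd u)) *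
      (N x1 u (fst (fst y)) * N x1 u (snd (fst y)) * (N x1 u (fst (snd y)) * N x1 u (snd (snd y))))) \<partial>nu \<partial>nu \<partial>nu)"
    by (simp add: nn_integral_nu_pair[where f="\<lambda>u. \<integral>\<^sup>+y. H u y \<partial>nu" for H] nn_integral_cmult[symmetric] mult_ac)
  also have "\<dots> = (\<integral>\<^sup>+x1. \<integral>\<^sup>+y. qker e y * (\<integral>\<^sup>+u. ennreal (gauss (e *\<^sub>R snd u)) *
      (N x1 u (fst (fst y)) * N x1 u (snd (fst y)) * (N x1 u (fst (snd y)) * N x1 u (snd (snd y)))) \<partial>nu) \<partial>nu \<partial>nu)"
    by (intro nn_integral_cong, subst nn_integral_nu_Fubini) (auto simp: case_prod_beta nn_integral_cmult)
  also have "\<dots> \<le> (\<integral>\<^sup>+x1. \<integral>\<^sup>+y. qker e y * (c *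
      (F (fst (fst y)) * G (fst (fst y) - x1) * (F (snd (fst y)) * G (snd (fst y) - x1)) *
      (F (fst (snd y)) * G (fst (snd y) - x1) * (F (snd (snd y)) * G (snd (snd y) - x1))))) \<partial>nu \<partial>nu)"
    by (intro nn_integral_mono mult_left_mono step3) auto
  also have "\<dots> = c * (\<integral>\<^sup>+x1. \<integral>\<^sup>+y. qker e y *
      (F (fst (fst y)) * G (fst (fst y) - x1) * (F (snd (fst y)) * G (snd (fst y) - x1)) *
      (F (fst (snd y)) * G (fst (snd y) - x1) * (F (snd (snd y)) * G (snd (snd y) - x1)))) \<partial>nu \<partial>nu)"
    by (simp add: nn_integral_cmult[symmetric] mult_ac)
  \<comment> \<open>The convolution bound again, now in the first coordinates, yields the second
    factor \<open>c\<close>.\<close>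
  also have "\<dots> \<le> c * (c * ((\<integral>\<^sup>+a. (F a)\<^sup>2 \<partial>nu) * (\<integral>\<^sup>+a. (G a)\<^sup>2 \<partial>nu) * ((\<integral>\<^sup>+a. (F a)\<^sup>2 \<partial>nu) * (\<integral>\<^sup>+a. (G a)\<^sup>2 \<partial>nu))))"
    unfolding c_def by (intro mult_left_mono gaussian_convolution_bound e) auto
  also have "(\<integral>\<^sup>+a. (F a)\<^sup>2 \<partial>nu) = (\<integral>\<^sup>+t. ennreal (norm (f t)) ^ 2 \<partial>nu)"
    by (simp add: F_def nn_integral_nu_pair)
  also have "(\<integral>\<^sup>+a. (G a)\<^sup>2 \<partial>nu) = (\<integral>\<^sup>+t. ennreal (norm (g t)) ^ 2 \<partial>nu)"
    by (simp add: G_def nn_integral_nu_pair)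
  finally show ?thesis
    by (simp add: c_def power2_eq_square mult.assoc[symmetric] ennreal_mult[symmetric] power_mult power_mult_distrib mult_2 power_add)
qed

section \<open>Continuity of translations\<close>

lemma ennreal_tendsto_0_le:
  fixes f g :: "'a \<Rightarrow> ennreal"
  assumes "\<And>x. f x \<le> g x" "(g \<longlongrightarrow> 0) F"
  shows "(f \<longlongrightarrow> 0) F"
  using assms by (intro tendsto_sandwich[where f="\<lambda>_. 0" and g=f and h=g]) auto

definition L1_translation :: "('a::euclidean_space \<Rightarrow> real) \<Rightarrow> 'a \<Rightarrow> ennreal" where
  "L1_translation u s = (\<integral>\<^sup>+z. ennreal \<bar>u (z + s) - u z\<bar> \<partial>nu)"

text \<open>Three-term estimate: the approximation error in \<open>L^1\<close> enters twice, because
  translations preserve the measure.\<close>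

lemma L1_translation_tendsto_approx:
  fixes u :: "'a::euclidean_space \<Rightarrow> real"
  assumes [measurable]: "u \<in> borel_measurable borel"
    and approx: "\<And>e. 0 < e \<Longrightarrow> \<exists>v \<in> borel_measurable borel.
      (\<integral>\<^sup>+z. ennreal \<bar>u z - v z\<bar> \<partial>nu) < ennreal e \<and> (\<lambda>n. L1_translation v (s n)) \<longlonglongrightarrow> 0"
  shows "(\<lambda>n::nat. L1_translation u (s n)) \<longlonglongrightarrow> 0"
proof (rule order_tendstoI)
  fix a :: ennreal assume "0 < a"
  then obtain b where b: "0 < b" "b < a"
    using dense by blast
  then obtain e where e: "b = ennreal e" "0 < e"
    by (cases b) auto
  obtain v where [measurable]: "v \<in> borel_measurable borel"
    and v: "(\<integral>\<^sup>+z. ennreal \<bar>u z - v z\<bar> \<partial>nu) < ennreal (e / 4)" "(\<lambda>n. L1_translation v (s n)) \<longlonglongrightarrow> 0"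
    using approx[of "e / 4"] e by auto
  have ev: "\<forall>\<^sub>F n in sequentially. L1_translation v (s n) < ennreal (e / 4)"
    using e by (intro order_tendstoD(2)[OF v(2)]) auto
  have le: "L1_translation u t \<le> (\<integral>\<^sup>+z. ennreal \<bar>u z - v z\<bar> \<partial>nu) + L1_translation v t +
      (\<integral>\<^sup>+z. ennreal \<bar>u z - v z\<bar> \<partial>nu)" for t
  proof -
    have "L1_translation u t \<le> (\<integral>\<^sup>+z. ennreal \<bar>u (z + t) - v (z + t)\<bar> + ennreal \<bar>v (z + t) - v z\<bar> + ennreal \<bar>u z - v z\<bar> \<partial>nu)"
      unfolding L1_translation_def
      by (intro nn_integral_mono) (auto simp flip: ennreal_plus intro!: ennreal_leI)
    also have "\<dots> = (\<integral>\<^sup>+z. ennreal \<bar>u (z + t) - v (z + t)\<bar> \<partial>nu) + L1_translation v t + (\<integral>\<^sup>+z. ennreal \<bar>u z - v z\<bar> \<partial>nu)"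
      by (simp add: nn_integral_add L1_translation_def)
    also have "(\<integral>\<^sup>+z. ennreal \<bar>u (z + t) - v (z + t)\<bar> \<partial>nu) = (\<integral>\<^sup>+z. ennreal \<bar>u z - v z\<bar> \<partial>nu)"
      by (rule nn_integral_nu_shift[where f="\<lambda>z. ennreal \<bar>u z - v z\<bar>"]) simp
    finally show ?thesis .
  qed
  show "\<forall>\<^sub>F n in sequentially. L1_translation u (s n) < a"
    using ev
  proof eventually_elim
    case (elim n)
    have "L1_translation u (s n) \<le> ennreal (e / 4) + ennreal (e / 4) + ennreal (e / 4)"
      using elim v(1) by (intro order.trans[OF le] add_mono) auto
    also have "\<dots> = ennreal (3 * e / 4)"
      using e by (simp flip: ennreal_plus)
    also have "\<dots> \<le> b"
      using e by (auto intro!: ennreal_leI)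
    finally show ?case
      using b by simp
  qed
qed auto

text \<open>\<open>T t\<close> is the measure of the points that leave \<open>U\<close> under
  translation by \<open>t\<close>. A point of an open set stays in it for small \<open>t\<close>, so
  dominated convergence applies; the points that enter \<open>U\<close> are counted by
  \<open>T (- t)\<close>.\<close>

lemma L1_translation_tendsto_open:
  fixes U :: "'a::euclidean_space set"
  assumes U: "open U" "emeasure nu U < \<infinity>" and s: "s \<longlonglongrightarrow> 0"
  shows "(\<lambda>n::nat. L1_translation (indicator U) (s n)) \<longlonglongrightarrow> 0"
proof -
  have [measurable]: "U \<in> sets borel"
    using U by simp
  define T where "T t = (\<integral>\<^sup>+z. indicator U z * indicator (- U) (z + t) \<partial>nu)" for t :: 'a
  have T: "(\<lambda>n. T (t n)) \<longlonglongrightarrow> 0" if t: "t \<longlonglongrightarrow> 0" for t :: "nat \<Rightarrow> 'a"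
  proof -
    have "(\<lambda>n. indicator U z * indicator (- U) (z + t n) :: ennreal) \<longlonglongrightarrow> 0" for z
    proof (cases "z \<in> U")
      case True
      have "(\<lambda>n. z + t n) \<longlonglongrightarrow> z"
        using tendsto_add[OF tendsto_const t, of z] by simp
      then have "\<forall>\<^sub>F n in sequentially. z + t n \<in> U"
        using True U(1) by (intro topological_tendstoD)
      then show ?thesis
        by (intro tendsto_eventually) (erule eventually_mono, simp)
    qed simp
    then have "(\<lambda>n. T (t n)) \<longlonglongrightarrow> (\<integral>\<^sup>+z. 0 \<partial>(nu :: 'a measure))"
      unfolding T_def using U(2)
      by (intro nn_integral_dominated_convergence[where w="indicator U"]) (auto split: split_indicator)
    then show ?thesis
      by simp
  qed
  have "L1_translation (indicator U) t = T t + T (- t)" for t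
  proof -
    have "L1_translation (indicator U) t =
      (\<integral>\<^sup>+z. indicator U z * indicator (- U) (z + t) + indicator U (z + t) * indicator (- U) (z + t + - t) \<partial>nu)"
      unfolding L1_translation_def by (intro nn_integral_cong) (auto simp: indicator_def)
    also have "\<dots> = T t + (\<integral>\<^sup>+z. indicator U (z + t) * indicator (- U) (z + t + - t) \<partial>nu)"
      unfolding T_def by (rule nn_integral_add) auto
    also have "(\<integral>\<^sup>+z. indicator U (z + t) * indicator (- U) (z + t + - t) \<partial>nu) = T (- t)"
      unfolding T_def by (rule nn_integral_nu_shift) simp
    finally show ?thesis .
  qed
  moreover have "(\<lambda>n. T (s n) + T (- s n)) \<longlonglongrightarrow> 0 + 0"
    using s tendsto_minus[OF s] by (intro tendsto_add T) auto
  ultimately show ?thesis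
    by simp
qed

text \<open>Holds because \<open>2 * pi \<ge> 1\<close>; it transfers outer regularity from
  \<open>lborel\<close> to \<open>nu\<close>.\<close>

lemma emeasure_nu_le:
  assumes "A \<in> sets borel" shows "emeasure nu A \<le> emeasure lborel (A :: 'a::euclidean_space set)"
proof -
  have "1 \<le> (2 * pi) powr (real DIM('a) / 2)"
    using pi_gt3 by (intro ge_one_powr_ge_zero) auto
  then have "ennreal (1 / (2 * pi) powr (real DIM('a) / 2)) \<le> 1"
    by (simp add: ennreal_le_1)
  from mult_right_mono[OF this, of "emeasure lborel A"] show ?thesis
    using assms nn_integral_nu[of "indicator A"] by simp
qed

text \<open>Induction over integrable functions: indicators reduce to open sets by outer regularity,
  and limits are handled by approximation in \<open>L^1\<close>.\<close>

lemma L1_translation_tendsto: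
  fixes u :: "'a::euclidean_space \<Rightarrow> real"
  assumes u: "integrable nu u" and s: "s \<longlonglongrightarrow> 0"
  shows "(\<lambda>n::nat. L1_translation u (s n)) \<longlonglongrightarrow> 0"
  using u
proof induction
  case (base A c)
  then have A [measurable]: "A \<in> sets borel"
    by simp
  have ind: "(\<lambda>n. L1_translation (indicator A) (s n)) \<longlonglongrightarrow> 0"
  proof (rule L1_translation_tendsto_approx)
    fix e :: real assume "0 < e"
    then obtain U where U: "open U" "A \<subseteq> U" "emeasure lborel (U - A) < e"
      using outer_regular_lborel[OF A] by blast
    have [measurable]: "U \<in> sets borel"
      using U by simp
    have UA: "emeasure nu (U - A) < e"
      using emeasure_nu_le[of "U - A"] U(3) by (simp add: order.strict_trans1)
    have "emeasure nu U \<le> emeasure nu A + emeasure nu (U - A)"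
      using emeasure_subadditive[of A nu "U - A"] U(2) by (simp add: Un_absorb1)
    also have "\<dots> < \<infinity>"
      using base UA by (simp add: order.strict_trans[OF UA])
    finally have "(\<lambda>n. L1_translation (indicator U) (s n)) \<longlonglongrightarrow> 0"
      using U s by (intro L1_translation_tendsto_open)
    moreover have "(\<integral>\<^sup>+z. ennreal \<bar>indicator A z - indicator U z\<bar> \<partial>nu) = (\<integral>\<^sup>+z. indicator (U - A) z \<partial>nu)"
      using U(2) by (intro nn_integral_cong) (auto simp: indicator_def)
    ultimately show "\<exists>v\<in>borel_measurable borel.
        (\<integral>\<^sup>+z. ennreal \<bar>indicator A z - v z\<bar> \<partial>nu) < ennreal e \<and> (\<lambda>n. L1_translation v (s n)) \<longlonglongrightarrow> 0"
      using UA by (intro bexI[of _ "indicator U"]) auto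
  qed simp
  have "L1_translation (\<lambda>x. indicator A x *\<^sub>R c) t = ennreal \<bar>c\<bar> * L1_translation (indicator A) t" for t
  proof -
    have "\<bar>indicator A (z + t) *\<^sub>R c - indicator A z *\<^sub>R c\<bar> = \<bar>c\<bar> * \<bar>indicator A (z + t) - indicator A z\<bar>" for z
      by (auto simp: indicator_def)
    then show ?thesis
      by (simp add: L1_translation_def ennreal_mult nn_integral_cmult)
  qed
  then show ?case
    using ennreal_tendsto_cmult[OF _ ind, of "ennreal \<bar>c\<bar>"] by simp
next
  case (add f g)
  then have [measurable]: "f \<in> borel_measurable borel" "g \<in> borel_measurable borel"
    by (auto dest: borel_measurable_integrable)
  have le: "L1_translation (\<lambda>x. f x + g x) t \<le> L1_translation f t + L1_translation g t" for t
    unfolding L1_translation_def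
    by (subst nn_integral_add[symmetric])
       (auto simp flip: ennreal_plus intro!: nn_integral_mono ennreal_leI)
  have "(\<lambda>n. L1_translation f (s n) + L1_translation g (s n)) \<longlonglongrightarrow> 0"
    using tendsto_add[OF add(3,4)] by simp
  with le show ?case
    by (rule ennreal_tendsto_0_le)
next
  case (lim f v)
  then have [measurable]: "f \<in> borel_measurable borel" "\<And>i. v i \<in> borel_measurable borel"
    by (auto dest: borel_measurable_integrable)
  show ?case
  proof (rule L1_translation_tendsto_approx)
    fix e :: real assume e: "0 < e"
    have "(\<lambda>i. \<integral>\<^sup>+z. ennreal \<bar>f z - v i z\<bar> \<partial>nu) \<longlonglongrightarrow> (\<integral>\<^sup>+z. 0 \<partial>(nu :: 'a measure))"
    \<comment> \<open>The approximants are bounded by \<open>2 * \<bar>f z\<bar>\<close>, whence the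
      factor 3.\<close>
    proof (rule nn_integral_dominated_convergence[where w="\<lambda>z. ennreal (3 * \<bar>f z\<bar>)"])
      show "AE z in nu. ennreal \<bar>f z - v i z\<bar> \<le> ennreal (3 * \<bar>f z\<bar>)" for i
        using lim(3)[of _ i] by (intro AE_I2 ennreal_leI) (smt (verit) UNIV_I real_norm_def space_nu)
      show "(\<integral>\<^sup>+z. ennreal (3 * \<bar>f z\<bar>) \<partial>nu) < \<infinity>"
        using lim(4) by (simp add: ennreal_mult nn_integral_cmult integrable_iff_bounded ennreal_mult_less_top)
      have "(\<lambda>i. \<bar>f z - v i z\<bar>) \<longlonglongrightarrow> \<bar>f z - f z\<bar>" for z
        using lim(2) by (intro tendsto_intros) auto
      then show "AE z in nu. (\<lambda>i. ennreal \<bar>f z - v i z\<bar>) \<longlonglongrightarrow> 0"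
        by (intro AE_I2) (use tendsto_ennrealI in fastforce)
    qed auto
    then have "\<forall>\<^sub>F i in sequentially. (\<integral>\<^sup>+z. ennreal \<bar>f z - v i z\<bar> \<partial>nu) < ennreal e"
      using e by (intro order_tendstoD(2)) auto
    then obtain i where "(\<integral>\<^sup>+z. ennreal \<bar>f z - v i z\<bar> \<partial>nu) < ennreal e"
      by (auto simp: eventually_sequentially)
    then show "\<exists>v\<in>borel_measurable borel.
        (\<integral>\<^sup>+z. ennreal \<bar>f z - v z\<bar> \<partial>nu) < ennreal e \<and> (\<lambda>n. L1_translation v (s n)) \<longlonglongrightarrow> 0"
      using lim(5) by (intro bexI[of _ "v i"]) auto
  qed simp
qed

text \<open>Reduced to \<open>L\<^sup>1\<close> through \<open>(a - b)\<^sup>2 \<le> 2 |a|a| - b|b||\<close>.\<close>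

lemma L2_translation_tendsto:
  fixes k :: "'a::euclidean_space \<Rightarrow> 'b::euclidean_space"
  assumes [measurable]: "k \<in> borel_measurable borel"
    and k: "(\<integral>\<^sup>+z. ennreal ((norm (k z))\<^sup>2) \<partial>nu) < \<infinity>" and s: "s \<longlonglongrightarrow> 0"
  shows "(\<lambda>n::nat. \<integral>\<^sup>+z. ennreal ((norm (k (z + s n) - k z))\<^sup>2) \<partial>nu) \<longlonglongrightarrow> 0"
proof -
  \<comment> \<open>Signed squares of the coordinates: integrable because \<open>k\<close> is
    square-integrable.\<close>
  define u where "u b z = (k z \<bullet> b) * \<bar>k z \<bullet> b\<bar>" for b z
  have [measurable]: "u b \<in> borel_measurable borel" for b
    unfolding u_def by measurable
  have u: "integrable nu (u b)" if "b \<in> Basis" for b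
    unfolding integrable_iff_bounded
  proof
    have "norm (u b z) \<le> (norm (k z))\<^sup>2" for z
      using Basis_le_norm[OF that, of "k z"] abs_le_square_iff[of "k z \<bullet> b" "norm (k z)"]
      by (simp add: u_def abs_mult power2_eq_square)
    then have "(\<integral>\<^sup>+z. ennreal (norm (u b z)) \<partial>nu) \<le> (\<integral>\<^sup>+z. ennreal ((norm (k z))\<^sup>2) \<partial>nu)"
      by (intro nn_integral_mono ennreal_leI)
    then show "(\<integral>\<^sup>+z. ennreal (norm (u b z)) \<partial>nu) < \<infinity>"
      using k by (rule order.strict_trans1)
  qed simp
  have sq: "(a - b)\<^sup>2 \<le> 2 * \<bar>a * \<bar>a\<bar> - b * \<bar>b\<bar>\<bar>" for a b :: real
  proof -
    \<comment> \<open>By symmetry \<open>b \<le> a\<close>. Only opposite signs make the factor 2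
      necessary.\<close>
    have *: "(a - b)\<^sup>2 \<le> 2 * \<bar>a * \<bar>a\<bar> - b * \<bar>b\<bar>\<bar>" if "b \<le> a" for a b :: real
    proof -
      consider "0 \<le> b" | "b < 0" "0 \<le> a" | "a < 0"
        by linarith
      then show ?thesis
      proof cases
        case 1
        have "(a - b) * (a - b) \<le> (a - b) * (a + b)"
          using 1 that by (intro mult_left_mono) auto
        moreover have "0 \<le> (a - b) * (a + b)"
          using 1 that by (intro mult_nonneg_nonneg) auto
        ultimately show ?thesis
          using 1 that by (simp add: power2_eq_square algebra_simps)
      next
        case 2
        have "0 \<le> (a + b)\<^sup>2"
          by simp
        with 2 show ?thesis
          by (simp add: power2_eq_square algebra_simps)
      next
        case 3
        then have *: "a * a \<le> a * b" "a * b \<le> b * b"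
          using that by (auto intro: mult_left_mono_neg mult_right_mono_neg)
        have "\<bar>a * \<bar>a\<bar> - b * \<bar>b\<bar>\<bar> = b * b - a * a"
          using order.trans[OF *] 3 that
          by (subst abs_of_neg[of a], simp, subst abs_of_neg[of b], simp, subst abs_of_nonneg) auto
        moreover have "(a - b)\<^sup>2 = a * a - 2 * (a * b) + b * b"
          by (simp add: power2_eq_square algebra_simps)
        moreover have "a * a - 2 * (a * b) + b * b \<le> 2 * (b * b - a * a)"
          using * by argo
        ultimately show ?thesis
          by simp
      qed
    qed
    show ?thesis
      using *[of a b] *[of b a] by (cases "b \<le> a") (auto simp: power2_commute abs_minus_commute)
  qed
  have "(norm (k (z + t) - k z))\<^sup>2 \<le> (\<Sum>b\<in>Basis. 2 * \<bar>u b (z + t) - u b z\<bar>)" for z t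
  proof -
    have "(norm (k (z + t) - k z))\<^sup>2 = (\<Sum>b\<in>Basis. (k (z + t) \<bullet> b - k z \<bullet> b)\<^sup>2)"
      unfolding power2_norm_eq_inner by (subst euclidean_inner) (simp add: power2_eq_square inner_diff_left)
    then show ?thesis
      by (auto simp: u_def intro!: sum_mono sq)
  qed
  then have "(\<integral>\<^sup>+z. ennreal ((norm (k (z + t) - k z))\<^sup>2) \<partial>nu) \<le>
      (\<integral>\<^sup>+z. (\<Sum>b\<in>Basis. 2 * ennreal \<bar>u b (z + t) - u b z\<bar>) \<partial>nu)" for t
    by (intro nn_integral_mono) (auto simp: sum_ennreal ennreal_mult simp flip: ennreal_mult ennreal_numeral intro!: ennreal_leI)
  also have "\<dots>t = (\<Sum>b\<in>Basis. 2 * L1_translation (u b) t)" for t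
    by (simp add: nn_integral_sum nn_integral_cmult L1_translation_def)
  finally have le: "(\<integral>\<^sup>+z. ennreal ((norm (k (z + t) - k z))\<^sup>2) \<partial>nu) \<le> (\<Sum>b\<in>Basis. 2 * L1_translation (u b) t)" for t .
  have "(\<lambda>n. \<Sum>b\<in>Basis. 2 * L1_translation (u b) (s n)) \<longlonglongrightarrow> (\<Sum>b\<in>(Basis :: 'b set). 2 * 0)"
    by (intro tendsto_sum ennreal_tendsto_cmult L1_translation_tendsto u s) auto
  then have lim: "(\<lambda>n. \<Sum>b\<in>Basis. 2 * L1_translation (u b) (s n)) \<longlonglongrightarrow> 0"
    by simp
  show ?thesis
    by (rule ennreal_tendsto_0_le[OF le lim])
qed

section \<open>Plancherel's formula\<close>

definition qrot :: "'a::euclidean_space \<times> 'a \<Rightarrow> 'a \<times> 'a \<Rightarrow> quat \<Rightarrow> quat" where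
  "qrot w t p = left.rot (fst t \<bullet> fst w) (right.rot (snd t \<bullet> snd w) p)"

lemma norm_qrot [simp]: "norm (qrot w t p) = norm p"
  by (simp add: qrot_def)

lemma borel_measurable_qrot [measurable (raw)]:
  assumes [measurable]: "w \<in> borel_measurable M" "t \<in> borel_measurable M" "p \<in> borel_measurable M"
  shows "(\<lambda>v. qrot (w v) (t v) (p v)) \<in> borel_measurable M"
  unfolding qrot_def by measurable

lemma integrable_qrot:
  assumes "integrable nu h"
  shows "integrable nu (\<lambda>t. qrot w t (h t))"
proof -
  have [measurable]: "h \<in> borel_measurable borel"
    using assms by (auto dest: borel_measurable_integrable)
  show ?thesis
    using assms by (simp add: integrable_iff_bounded)
qed

lemma (in complex_structure) integral_rot:
  assumes "integrable M \<phi>"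
  shows "(LINT b|M. rot c (\<phi> b)) = rot c (LINT b|M. \<phi> b)"
proof -
  have "bounded_linear (rot c)"
    using linear_J by (intro linear_conv_bounded_linear[THEN iffD1] linearI)
      (auto simp: rot_def linear_add linear_scale algebra_simps)
  then show ?thesis
    using assms by (intro integral_bounded_linear)
qed

text \<open>Fubini, with the left rotation taken out of the inner integral. Slices of
  \<open>h\<close> are known to be integrable almost everywhere only, so the inner integrals are
  compared there.\<close>

lemma qft_eq_integral:
  fixes h :: "'a::euclidean_space \<times> 'a \<Rightarrow> quat"
  assumes h: "integrable nu h"
  shows "qft h w = (LINT t|nu. qrot w t (h t))"
proof -
  have [measurable]: "h \<in> borel_measurable borel"
    using h by (auto dest: borel_measurable_integrable)
  have "AE a in nu. (LINT b|nu. qrot w (a, b) (h (a, b))) =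
      left.rot (a \<bullet> fst w) (right.trans (\<lambda>b. h (a, b)) (snd w))"
    using integral_nu_pair(3)[OF h]
  proof eventually_elim
    case (elim a)
    then have "integrable nu (\<lambda>b. right.rot (b \<bullet> snd w) (h (a, b)))"
      by (subst right.integrable_rot_iff) auto
    then show ?case
      by (simp add: qrot_def right.trans_def left.integral_rot)
  qed
  then show ?thesis
    unfolding qft_def left.trans_def integral_nu_pair(1)[OF integrable_qrot[OF h]]
    by (intro integral_cong_AE[symmetric]) auto
qed

lemma gker_Pair: "gker e (s, t) = gker e s * gker e t"
  by (simp add: gker_def gauss_Pair power_add)

lemma inner_qrot_qrot:
  "qrot w t p \<bullet> qrot w t' p' =
    cos ((fst t - fst t') \<bullet> fst w) * (cos ((snd t - snd t') \<bullet> snd w) * (p \<bullet> p') - sin ((snd t - snd t') \<bullet> snd w) * ((p * quat_j) \<bullet> p')) -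
    sin ((fst t - fst t') \<bullet> fst w) * (cos ((snd t - snd t') \<bullet> snd w) * ((quat_i * p) \<bullet> p') - sin ((snd t - snd t') \<bullet> snd w) * ((quat_i * p * quat_j) \<bullet> p'))"
proof -
  \<comment> \<open>By associativity \<open>quat_i\<close> passes through the right rotation, so
    \<open>right.inner_rot_rot\<close> also covers the term with \<open>quat_i\<close>.\<close>
  have "quat_i * right.rot b p = right.rot b (quat_i * p)" for b
    by (simp add: right_rot_eq mult.assoc)
  then show ?thesis
    by (simp add: qrot_def left.inner_rot_rot right.inner_rot_rot inner_diff_left)
qed

lemma gauss_trig_integral_single:
  fixes s :: "'a::euclidean_space"
  assumes e: "0 < e"
  shows "(LINT w|nu. gauss (e *\<^sub>R w) * (cos (s \<bullet> w) * A - sin (s \<bullet> w) * B)) = gker e s * A"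
  \<comment> \<open>Frequency 0 with coefficients 1 and 0 makes the second factor 1, and the two
    kernels coincide.\<close>
  using gauss_trig_integral[OF e, of s A B 0 1 0] by simp

text \<open>Integration over \<open>w1\<close> removes the terms with a sine in the first variable,
  integration over \<open>w2\<close> the remaining sine, so no term with \<open>quat_i\<close> or
  \<open>quat_j\<close> survives.\<close>

lemma gauss_qrot_integral:
  fixes t t' :: "'a::euclidean_space \<times> 'a"
  assumes e: "0 < e"
  shows "(LINT w|nu. gauss (e *\<^sub>R w) * (qrot w t p \<bullet> qrot w t' p')) = gker e (t - t') * (p \<bullet> p')"
proof -
  have "\<bar>qrot w t p \<bullet> qrot w t' p'\<bar> \<le> norm p * norm p'" for w
    using Cauchy_Schwarz_ineq2[of "qrot w t p" "qrot w t' p'"] by simp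
  then have I: "integrable nu (\<lambda>w. gauss (e *\<^sub>R w) * (qrot w t p \<bullet> qrot w t' p'))"
    by (intro integrable_gauss_bounded[where B="norm p * norm p'"] e) auto
  have "(LINT w1|nu. gauss (e *\<^sub>R (w1, w2)) * (qrot (w1, w2) t p \<bullet> qrot (w1, w2) t' p')) =
    gker e (fst t - fst t') * (gauss (e *\<^sub>R w2) *
      (cos ((snd t - snd t') \<bullet> w2) * (p \<bullet> p') - sin ((snd t - snd t') \<bullet> w2) * ((p * quat_j) \<bullet> p')))" for w2
  proof -
    have "(LINT w1|nu. gauss (e *\<^sub>R (w1, w2)) * (qrot (w1, w2) t p \<bullet> qrot (w1, w2) t' p')) =
      (LINT w1|nu. gauss (e *\<^sub>R w2) * (gauss (e *\<^sub>R w1) * (qrot (w1, w2) t p \<bullet> qrot (w1, w2) t' p')))"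
      by (simp add: gauss_Pair mult_ac)
    also have "\<dots> = gauss (e *\<^sub>R w2) * (LINT w1|nu. gauss (e *\<^sub>R w1) * (qrot (w1, w2) t p \<bullet> qrot (w1, w2) t' p'))"
      by (rule integral_mult_right_zero)
    finally show ?thesis
      unfolding inner_qrot_qrot fst_conv snd_conv gauss_trig_integral_single[OF e] by simp
  qed
  then show ?thesis
    unfolding integral_nu_pair(2)[OF I]
    by (simp add: gauss_trig_integral_single[OF e] gker_Pair[of e "fst t - fst t'" "snd t - snd t'", symmetric] minus_prod_def)
qed

text \<open>The square is expanded as a double integral; integration over \<open>w\<close> turns the
  rotations into a kernel that concentrates on the diagonal as \<open>e\<close> tends to 0.\<close>

lemma nn_integral_gauss_qft:
  fixes h :: "'a::euclidean_space \<times> 'a \<Rightarrow> quat"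
  assumes h: "integrable nu h" and e: "0 < e"
  shows "(\<integral>\<^sup>+w. ennreal (gauss (e *\<^sub>R w) * (norm (qft h w))\<^sup>2) \<partial>nu) =
    ennreal (LINT z|nu. gker e (fst z - snd z) * (h (fst z) \<bullet> h (snd z)))"
proof -
  have [measurable]: "h \<in> borel_measurable borel"
    using h by (auto dest: borel_measurable_integrable)
  define K where "K v = gauss (e *\<^sub>R snd v) * (qrot (snd v) (fst (fst v)) (h (fst (fst v))) \<bullet>
      qrot (snd v) (snd (fst v)) (h (snd (fst v))))" for v
  have K: "integrable nu K"
  proof (rule Bochner_Integration.integrable_bound)
    show "integrable nu (\<lambda>v :: (('a \<times> 'a) \<times> 'a \<times> 'a) \<times> 'a \<times> 'a.
        (norm (h (fst (fst v))) * norm (h (snd (fst v)))) * gauss (e *\<^sub>R snd v))"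
      by (intro integrable_nu_times[where f="\<lambda>z. norm (h (fst z)) * norm (h (snd z))"]
        integrable_nu_times integrable_norm h gker_transform e)
    show "K \<in> borel_measurable nu"
      unfolding K_def by measurable
    have "\<bar>qrot w t (h t) \<bullet> qrot w t' (h t')\<bar> \<le> norm (h t) * norm (h t')" for w t t'
      using Cauchy_Schwarz_ineq2[of "qrot w t (h t)" "qrot w t' (h t')"] by simp
    then have "norm (K v) \<le> gauss (e *\<^sub>R snd v) * (norm (h (fst (fst v))) * norm (h (snd (fst v))))" for v
      unfolding K_def real_norm_def abs_mult by (intro mult_mono) simp_all
    then show "AE v in nu. norm (K v) \<le> norm ((norm (h (fst (fst v))) * norm (h (snd (fst v)))) * gauss (e *\<^sub>R snd v))"
      by (intro AE_I2) (simp add: mult.commute)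
  qed
  have eq: "gauss (e *\<^sub>R w) * (norm (qft h w))\<^sup>2 = (LINT z|nu. K (z, w))" for w
    unfolding qft_eq_integral[OF h] norm_integral_squared(2)[OF integrable_qrot[OF h]]
    by (simp add: K_def)
  have "(\<integral>\<^sup>+w. ennreal (gauss (e *\<^sub>R w) * (norm (qft h w))\<^sup>2) \<partial>nu) = ennreal (LINT w|nu. LINT z|nu. K (z, w))"
    using integral_nu_pair(4)[OF K] unfolding eq[symmetric] by (intro nn_integral_eq_integral) auto
  also have "\<dots> = ennreal (LINT z|nu. LINT w|nu. K (z, w))"
    using integral_nu_pair(1,2)[OF K] by simp
  finally show ?thesis
    by (simp add: K_def gauss_qrot_integral[OF e])
qed

lemma nn_integral_gker_diff:
  fixes F :: "'a::euclidean_space \<Rightarrow> ennreal"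
  assumes [measurable]: "F \<in> borel_measurable borel" and e: "0 < e"
  shows "(\<integral>\<^sup>+z. ennreal (gker e (fst z - snd z)) * F (fst z) \<partial>nu) = (\<integral>\<^sup>+x. F x \<partial>nu)"
    and "(\<integral>\<^sup>+z. ennreal (gker e (fst z - snd z)) * F (snd z) \<partial>nu) = (\<integral>\<^sup>+x. F x \<partial>nu)"
proof -
  have *: "(\<integral>\<^sup>+y. ennreal (gker e (x - y)) \<partial>nu) = 1" for x :: 'a
    using nn_integral_gker_affine[OF e, of "-1" x] by simp
  show 1: "(\<integral>\<^sup>+z. ennreal (gker e (fst z - snd z)) * F (fst z) \<partial>nu) = (\<integral>\<^sup>+x. F x \<partial>nu)"
    by (simp add: nn_integral_nu_pair nn_integral_multc *)
  have "(\<integral>\<^sup>+z. ennreal (gker e (fst z - snd z)) * F (snd z) \<partial>nu) =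
      (\<integral>\<^sup>+z. ennreal (gker e (fst (snd z, fst z) - snd (snd z, fst z))) * F (fst (snd z, fst z)) \<partial>nu)"
    by (simp add: gker_minus_commute[of e "snd _"])
  also have "\<dots> = (\<integral>\<^sup>+x. F x \<partial>nu)"
    unfolding 1[symmetric] by (rule nn_integral_nu_swap) simp
  finally show "(\<integral>\<^sup>+z. ennreal (gker e (fst z - snd z)) * F (snd z) \<partial>nu) = (\<integral>\<^sup>+x. F x \<partial>nu)" .
qed

lemma norm_diff_squared_le: "(norm (a - b))\<^sup>2 \<le> 2 * (norm a)\<^sup>2 + 2 * (norm (b :: 'b::real_normed_vector))\<^sup>2"
proof -
  have "(norm (a - b))\<^sup>2 \<le> (norm a + norm b)\<^sup>2"
    by (intro power_mono norm_triangle_ineq4) auto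
  also have "\<dots> \<le> 2 * (norm a)\<^sup>2 + 2 * (norm b)\<^sup>2"
    using sum_squares_bound[of "norm a" "norm b"] by (simp add: power2_sum)
  finally show ?thesis .
qed

text \<open>By polarization and the unit mass of the kernel, the weighted integral is the full
  \<open>L^2\<close> mass minus half the integral of \<open>d\<close>. The first bound drops
  \<open>d\<close>, the second keeps it as an error term.\<close>

lemma gauss_qft_bounds:
  fixes h :: "'a::euclidean_space \<times> 'a \<Rightarrow> quat"
  assumes h: "integrable nu h" and e: "0 < e" and h2: "(\<integral>\<^sup>+t. ennreal ((norm (h t))\<^sup>2) \<partial>nu) < \<infinity>"
  shows "(\<integral>\<^sup>+w. ennreal (gauss (e *\<^sub>R w) * (norm (qft h w))\<^sup>2) \<partial>nu) \<le> (\<integral>\<^sup>+t. ennreal ((norm (h t))\<^sup>2) \<partial>nu)"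
    and "(\<integral>\<^sup>+t. ennreal ((norm (h t))\<^sup>2) \<partial>nu) \<le>
      (\<integral>\<^sup>+w. ennreal (gauss (e *\<^sub>R w) * (norm (qft h w))\<^sup>2) \<partial>nu) +
      (\<integral>\<^sup>+z. ennreal (gker e (fst z - snd z)) * ennreal ((norm (h (fst z) - h (snd z)))\<^sup>2) \<partial>nu)"
proof -
  have [measurable]: "h \<in> borel_measurable borel"
    using h by (auto dest: borel_measurable_integrable)
  define S where "S = (LINT t|nu. (norm (h t))\<^sup>2)"
  define p where "p z = gker e (fst z - snd z) * (norm (h (fst z)))\<^sup>2" for z
  define q where "q z = gker e (fst z - snd z) * (norm (h (snd z)))\<^sup>2" for z
  define d where "d z = gker e (fst z - snd z) * (norm (h (fst z) - h (snd z)))\<^sup>2" for z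
  have [measurable]: "p \<in> borel_measurable borel" "q \<in> borel_measurable borel" "d \<in> borel_measurable borel"
    unfolding p_def q_def d_def by measurable
  have nonneg: "0 \<le> p z" "0 \<le> q z" "0 \<le> d z" for z
    unfolding p_def q_def d_def by (intro mult_nonneg_nonneg gker_nonneg e; simp)+
  have "integrable nu (\<lambda>t. (norm (h t))\<^sup>2)"
    using h2 by (auto simp: integrable_iff_bounded)
  then have S: "ennreal S = (\<integral>\<^sup>+t. ennreal ((norm (h t))\<^sup>2) \<partial>nu)" "0 \<le> S"
    unfolding S_def by (auto simp: nn_integral_eq_integral)
  have pn: "(\<integral>\<^sup>+z. ennreal (p z) \<partial>nu) = ennreal S" "(\<integral>\<^sup>+z. ennreal (q z) \<partial>nu) = ennreal S"
    using nn_integral_gker_diff[of "\<lambda>t. ennreal ((norm (h t))\<^sup>2)", OF _ e]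
    by (auto simp: p_def q_def S ennreal_mult gker_nonneg[OF e])
  have pq: "integrable nu p" "integrable nu q"
    using pn nonneg by (auto simp: integrable_iff_bounded)
  have pI: "(LINT z|nu. p z) = S" "(LINT z|nu. q z) = S"
    using pn S(2) nonneg by (auto simp: integral_eq_nn_integral)
  have d: "integrable nu d"
  proof (rule Bochner_Integration.integrable_bound)
    show "integrable nu (\<lambda>z. 2 * (p z + q z))"
      using pq by simp
    have "d z \<le> 2 * (p z + q z)" for z
    proof -
      have "d z \<le> gker e (fst z - snd z) * (2 * (norm (h (fst z)))\<^sup>2 + 2 * (norm (h (snd z)))\<^sup>2)"
        unfolding d_def by (intro mult_left_mono gker_nonneg e norm_diff_squared_le)
      then show ?thesis
        by (simp add: p_def q_def algebra_simps)
    qed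
    then show "AE z in nu. norm (d z) \<le> norm (2 * (p z + q z))"
      using nonneg by (intro AE_I2) (smt (verit) real_norm_def)
  qed simp
  have eq: "gker e (fst z - snd z) * (h (fst z) \<bullet> h (snd z)) = (p z + q z - d z) / 2" for z
    by (simp add: p_def q_def d_def power2_norm_eq_inner inner_diff_left inner_diff_right inner_commute algebra_simps)
  have L: "(LINT z|nu. gker e (fst z - snd z) * (h (fst z) \<bullet> h (snd z))) = S - (LINT z|nu. d z) / 2"
    unfolding eq using pq d by (simp add: pI diff_divide_distrib)
  have D: "0 \<le> (LINT z|nu. d z)" "(\<integral>\<^sup>+z. ennreal (d z) \<partial>nu) = ennreal (LINT z|nu. d z)"
    using nonneg(3) by (simp, intro nn_integral_eq_integral d) simp
  show "(\<integral>\<^sup>+w. ennreal (gauss (e *\<^sub>R w) * (norm (qft h w))\<^sup>2) \<partial>nu) \<le> (\<integral>\<^sup>+t. ennreal ((norm (h t))\<^sup>2) \<partial>nu)"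
    unfolding nn_integral_gauss_qft[OF h e] L S(1)[symmetric] using D by (intro ennreal_leI) auto
  \<comment> \<open>\<open>ennreal\<close> sends negative reals to 0, hence the
    \<open>max\<close>.\<close>
  have "(\<integral>\<^sup>+t. ennreal ((norm (h t))\<^sup>2) \<partial>nu) \<le> ennreal (max 0 (S - (LINT z|nu. d z) / 2) + (LINT z|nu. d z))"
    unfolding S(1)[symmetric] using D by (intro ennreal_leI) auto
  also have "\<dots> = ennreal (S - (LINT z|nu. d z) / 2) + (\<integral>\<^sup>+z. ennreal (d z) \<partial>nu)"
    unfolding D(2) using D(1) by (subst ennreal_plus) (auto simp: max_def ennreal_neg)
  finally show "(\<integral>\<^sup>+t. ennreal ((norm (h t))\<^sup>2) \<partial>nu) \<le>
      (\<integral>\<^sup>+w. ennreal (gauss (e *\<^sub>R w) * (norm (qft h w))\<^sup>2) \<partial>nu) +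
      (\<integral>\<^sup>+z. ennreal (gker e (fst z - snd z)) * ennreal ((norm (h (fst z) - h (snd z)))\<^sup>2) \<partial>nu)"
    unfolding nn_integral_gauss_qft[OF h e] L d_def by (simp add: ennreal_mult gker_nonneg[OF e])
qed

lemma gauss_tendsto_1:
  fixes w :: "'a::euclidean_space"
  shows "(\<lambda>n. gauss (inverse (real (Suc n)) *\<^sub>R w)) \<longlonglongrightarrow> 1"
proof -
  have "(\<lambda>n. gauss (inverse (real (Suc n)) *\<^sub>R w)) \<longlonglongrightarrow> exp (- (norm (0 *\<^sub>R w))\<^sup>2 / 2)"
    unfolding gauss_def by (intro tendsto_intros LIMSEQ_inverse_real_of_nat) auto
  then show ?thesis
    by simp
qed

text \<open>Fatou's lemma along \<open>e = 1 / (n + 1)\<close> removes the weight from a bound that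
  is uniform in \<open>e\<close>.\<close>

lemma nn_integral_le_of_gauss_weighted:
  fixes H :: "'a::euclidean_space \<Rightarrow> 'b::euclidean_space \<Rightarrow> real"
  assumes [measurable]: "case_prod H \<in> borel_measurable borel"
    and le: "\<And>e. 0 < e \<Longrightarrow> (\<integral>\<^sup>+x. \<integral>\<^sup>+w. ennreal (gauss (e *\<^sub>R w) * H x w) \<partial>nu \<partial>nu) \<le> B"
  shows "(\<integral>\<^sup>+x. \<integral>\<^sup>+w. ennreal (H x w) \<partial>nu \<partial>nu) \<le> B"
proof -
  define u where "u n z = ennreal (gauss (inverse (real (Suc n)) *\<^sub>R snd z) * case_prod H z)" for n z
  have [measurable]: "u n \<in> borel_measurable borel" for n
    unfolding u_def by measurable
  have "(\<lambda>n. u n z) \<longlonglongrightarrow> ennreal (1 * case_prod H z)" for z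
    unfolding u_def by (intro tendsto_ennrealI tendsto_mult gauss_tendsto_1 tendsto_const)
  then have "liminf (\<lambda>n. u n z) = ennreal (case_prod H z)" for z
    by (simp add: lim_imp_Liminf)
  then have "(\<integral>\<^sup>+z. ennreal (case_prod H z) \<partial>nu) \<le> liminf (\<lambda>n. integral\<^sup>N nu (u n))"
    using nn_integral_liminf[of u nu] by simp
  also have "\<dots> \<le> liminf (\<lambda>n. B)"
  proof (intro Liminf_mono always_eventually allI)
    fix n
    show "integral\<^sup>N nu (u n) \<le> B"
      using le[of "inverse (real (Suc n))"] by (subst nn_integral_nu_pair) (auto simp: u_def)
  qed
  finally show ?thesis
    by (simp add: nn_integral_nu_pair Liminf_const)
qed

text \<open>For fixed \<open>x\<close> the product is integrable, but its square only for almost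
  every \<open>x\<close>, so Plancherel's formula is proved after integration over \<open>x\<close>.
  Fatou gives one inequality, continuity of translations in \<open>L^2\<close> the other.\<close>

lemma qft_hprod_plancherel:
  fixes f g :: "'a::euclidean_space \<times> 'a \<Rightarrow> quat"
  assumes [measurable]: "f \<in> borel_measurable borel" "g \<in> borel_measurable borel"
    and f: "(\<integral>\<^sup>+t. ennreal ((norm (f t))\<^sup>2) \<partial>nu) < \<infinity>" and g: "(\<integral>\<^sup>+t. ennreal ((norm (g t))\<^sup>2) \<partial>nu) < \<infinity>"
  shows "integrable nu (hprod f g x)"
    and "(\<integral>\<^sup>+x. \<integral>\<^sup>+w. ennreal ((norm (qft (hprod f g x) w))\<^sup>2) \<partial>nu \<partial>nu) =
      (\<integral>\<^sup>+t. ennreal ((norm (f t))\<^sup>2) \<partial>nu) * (\<integral>\<^sup>+t. ennreal ((norm (g t))\<^sup>2) \<partial>nu)"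
proof -
  show int: "integrable nu (hprod f g x)" for x
  proof (rule Bochner_Integration.integrable_bound)
    have F: "integrable nu (\<lambda>t. (norm (f t))\<^sup>2)"
      using f by (simp add: integrable_iff_bounded)
    have G: "integrable nu (\<lambda>t. (norm (g (t - x)))\<^sup>2)"
      using g nn_integral_nu_shift[of "\<lambda>t. ennreal ((norm (g t))\<^sup>2)" "-x"] by (simp add: integrable_iff_bounded)
    show "integrable nu (\<lambda>t. (norm (f t))\<^sup>2 + (norm (g (t - x)))\<^sup>2)"
      using F G by simp
    have "norm (f t) * norm (g (t - x)) \<le> (norm (f t))\<^sup>2 + (norm (g (t - x)))\<^sup>2" for t
      using sum_squares_bound[of "norm (f t)" "norm (g (t - x))"]
        mult_nonneg_nonneg[OF norm_ge_zero[of "f t"] norm_ge_zero[of "g (t - x)"]] by linarith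
    then show "AE t in nu. norm (hprod f g x t) \<le> norm ((norm (f t))\<^sup>2 + (norm (g (t - x)))\<^sup>2)"
      by (intro AE_I2) (simp add: hprod_def norm_quat_mult)
  qed simp
  define K where "K = (\<integral>\<^sup>+t. ennreal ((norm (f t))\<^sup>2) \<partial>nu) * (\<integral>\<^sup>+t. ennreal ((norm (g t))\<^sup>2) \<partial>nu)"
  define S where "S x = (\<integral>\<^sup>+t. ennreal ((norm (hprod f g x t))\<^sup>2) \<partial>nu)" for x
  define I where "I e x = (\<integral>\<^sup>+w. ennreal (gauss (e *\<^sub>R w) * (norm (qft (hprod f g x) w))\<^sup>2) \<partial>nu)" for e x
  define Q where "Q e x = (\<integral>\<^sup>+z. ennreal (gker e (fst z - snd z)) *
      ennreal ((norm (hprod f g x (fst z) - hprod f g x (snd z)))\<^sup>2) \<partial>nu)" for e x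
  \<comment> \<open>\<open>hprod f g x t\<close> is \<open>k (t, t - x)\<close>, and a translation
    of \<open>t\<close> becomes a diagonal translation of the single square-integrable function
    \<open>k\<close>.\<close>
  define k where "k z = f (fst z) * qcnj (g (snd z))" for z
  define D where "D s = (\<integral>\<^sup>+z. ennreal ((norm (k (z + (s, s)) - k z))\<^sup>2) \<partial>nu)" for s
  have [measurable]: "S \<in> borel_measurable borel" "I e \<in> borel_measurable borel" "Q e \<in> borel_measurable borel"
      "k \<in> borel_measurable borel" for e
    unfolding S_def I_def Q_def k_def by measurable
  have [measurable]: "D \<in> borel_measurable borel"
    unfolding D_def by measurable
  have K: "K < \<infinity>"
    using f g by (simp add: K_def ennreal_mult_less_top)
  have kK: "(\<integral>\<^sup>+z. ennreal ((norm (k z))\<^sup>2) \<partial>nu) = K"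
    unfolding K_def by (subst nn_integral_nu_times[symmetric])
      (auto simp: k_def norm_quat_mult power_mult_distrib ennreal_mult)
  have change: "(\<integral>\<^sup>+x. \<integral>\<^sup>+t. F (t, t - x) \<partial>nu \<partial>nu) = (\<integral>\<^sup>+z. F z \<partial>nu)"
    if [measurable]: "F \<in> borel_measurable borel" for F :: "('a \<times> 'a) \<times> ('a \<times> 'a) \<Rightarrow> ennreal"
  proof -
    have "(\<integral>\<^sup>+x. \<integral>\<^sup>+t. F (t, t - x) \<partial>nu \<partial>nu) = (\<integral>\<^sup>+t. \<integral>\<^sup>+x. F (t, t - x) \<partial>nu \<partial>nu)"
      by (rule nn_integral_nu_Fubini) (simp add: case_prod_beta)
    also have "\<dots> = (\<integral>\<^sup>+t. \<integral>\<^sup>+y. F (t, y) \<partial>nu \<partial>nu)"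
      by (intro nn_integral_cong nn_integral_nu_reflect[where f="\<lambda>y. F (t, y)" for t]) simp
    finally show ?thesis
      by (simp add: nn_integral_nu_pair)
  qed
  have hk: "hprod f g x t = k (t, t - x)" for x t
    by (simp add: hprod_def k_def)
  have SK: "(\<integral>\<^sup>+x. S x \<partial>nu) = K"
    unfolding S_def hk kK[symmetric] by (rule change) simp
  have IS: "I e x \<le> S x" if "0 < e" for e x
    using gauss_qft_bounds(1)[OF int that, of x] unfolding I_def S_def
    by (cases "(\<integral>\<^sup>+t. ennreal ((norm (hprod f g x t))\<^sup>2) \<partial>nu) < \<infinity>") (auto simp: less_top[symmetric])
  \<comment> \<open>The substitution \<open>u = s + t\<close> and a rescaling of \<open>s\<close> by
    \<open>e\<close> express the total error as a Gaussian average of translation errors of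
    \<open>k\<close>.\<close>
  have QD: "(\<integral>\<^sup>+x. Q e x \<partial>nu) = (\<integral>\<^sup>+s. ennreal (gauss s) * D (e *\<^sub>R s) \<partial>nu)" if e: "0 < e" for e
  proof -
    have "Q e x = (\<integral>\<^sup>+s. \<integral>\<^sup>+t. ennreal (gker e s) * ennreal ((norm (k ((t, t - x) + (s, s)) - k (t, t - x)))\<^sup>2) \<partial>nu \<partial>nu)" for x
    proof -
      have "Q e x = (\<integral>\<^sup>+t. \<integral>\<^sup>+u. ennreal (gker e (t - u)) * ennreal ((norm (hprod f g x t - hprod f g x u))\<^sup>2) \<partial>nu \<partial>nu)"
        unfolding Q_def by (subst nn_integral_nu_pair) auto
      also have "\<dots> = (\<integral>\<^sup>+t. \<integral>\<^sup>+s. ennreal (gker e (t - (s + t))) * ennreal ((norm (hprod f g x t - hprod f g x (s + t)))\<^sup>2) \<partial>nu \<partial>nu)"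
        by (intro nn_integral_cong nn_integral_nu_shift[symmetric]) simp
      also have "\<dots> = (\<integral>\<^sup>+s. \<integral>\<^sup>+t. ennreal (gker e (t - (s + t))) * ennreal ((norm (hprod f g x t - hprod f g x (s + t)))\<^sup>2) \<partial>nu \<partial>nu)"
        by (rule nn_integral_nu_Fubini) (simp add: case_prod_beta)
      also have "\<dots> = (\<integral>\<^sup>+s. \<integral>\<^sup>+t. ennreal (gker e s) * ennreal ((norm (k ((t, t - x) + (s, s)) - k (t, t - x)))\<^sup>2) \<partial>nu \<partial>nu)"
        by (simp add: hk norm_minus_commute algebra_simps)
      finally show ?thesis .
    qed
    then have "(\<integral>\<^sup>+x. Q e x \<partial>nu) =
      (\<integral>\<^sup>+x. \<integral>\<^sup>+s. \<integral>\<^sup>+t. ennreal (gker e s) * ennreal ((norm (k ((t, t - x) + (s, s)) - k (t, t - x)))\<^sup>2) \<partial>nu \<partial>nu \<partial>nu)"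
      by simp
    also have "\<dots> =
      (\<integral>\<^sup>+s. \<integral>\<^sup>+x. \<integral>\<^sup>+t. ennreal (gker e s) * ennreal ((norm (k ((t, t - x) + (s, s)) - k (t, t - x)))\<^sup>2) \<partial>nu \<partial>nu \<partial>nu)"
      by (rule nn_integral_nu_Fubini) (simp add: case_prod_beta)
    also have "\<dots> = (\<integral>\<^sup>+s. ennreal (gker e s) * D s \<partial>nu)"
    proof (intro nn_integral_cong)
      fix s :: "'a \<times> 'a"
      show "(\<integral>\<^sup>+x. \<integral>\<^sup>+t. ennreal (gker e s) * ennreal ((norm (k ((t, t - x) + (s, s)) - k (t, t - x)))\<^sup>2) \<partial>nu \<partial>nu) =
        ennreal (gker e s) * D s"
        unfolding D_def
        by (subst change[where F="\<lambda>z. ennreal (gker e s) * ennreal ((norm (k (z + (s, s)) - k z))\<^sup>2)"])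
          (auto simp: nn_integral_cmult)
    qed
    also have "\<dots> = ennreal (1 / \<bar>e\<bar> ^ DIM('a \<times> 'a)) * (\<integral>\<^sup>+s. ennreal (gauss ((1 / e) *\<^sub>R s)) * D s \<partial>nu)"
      using e by (subst nn_integral_cmult[symmetric])
        (auto simp: gker_def ennreal_mult'[symmetric] mult.assoc[symmetric])
    also have "\<dots> = (\<integral>\<^sup>+s. ennreal (gauss ((1 / e) *\<^sub>R (0 + e *\<^sub>R s))) * D (0 + e *\<^sub>R s) \<partial>nu)"
      using e by (intro nn_integral_nu_affine[symmetric]) auto
    also have "\<dots> = (\<integral>\<^sup>+s. ennreal (gauss s) * D (e *\<^sub>R s) \<partial>nu)"
      using e by simp
    finally show ?thesis .
  qed
  \<comment> \<open>Provides the dominating function for the limit \<open>R0\<close>.\<close>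
  have D4: "D s \<le> 4 * K" for s
  proof -
    have "D s \<le> (\<integral>\<^sup>+z. 2 * ennreal ((norm (k (z + (s, s))))\<^sup>2) + 2 * ennreal ((norm (k z))\<^sup>2) \<partial>nu)"
      unfolding D_def
    proof (intro nn_integral_mono)
      fix z
      show "ennreal ((norm (k (z + (s, s)) - k z))\<^sup>2) \<le> 2 * ennreal ((norm (k (z + (s, s))))\<^sup>2) + 2 * ennreal ((norm (k z))\<^sup>2)"
        using ennreal_leI[OF norm_diff_squared_le[of "k (z + (s, s))" "k z"]] by (simp add: ennreal_plus ennreal_mult)
    qed
    also have "\<dots> = 2 * (\<integral>\<^sup>+z. ennreal ((norm (k (z + (s, s))))\<^sup>2) \<partial>nu) + 2 * K"
      by (simp add: nn_integral_add nn_integral_cmult kK)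
    also have "(\<integral>\<^sup>+z. ennreal ((norm (k (z + (s, s))))\<^sup>2) \<partial>nu) = K"
      unfolding kK[symmetric] by (rule nn_integral_nu_shift) simp
    also have "2 * K + 2 * K = 4 * K"
      by (simp add: distrib_right[symmetric])
    finally show ?thesis .
  qed
  have R0: "(\<lambda>n. \<integral>\<^sup>+s. ennreal (gauss s) * D (inverse (real (Suc n)) *\<^sub>R s) \<partial>nu) \<longlonglongrightarrow> (\<integral>\<^sup>+s. 0 \<partial>(nu :: ('a \<times> 'a) measure))"
  proof (rule nn_integral_dominated_convergence[where w="\<lambda>s. ennreal (gauss s) * (4 * K)"])
    show "(\<integral>\<^sup>+s. ennreal (gauss s) * (4 * K) \<partial>(nu :: ('a \<times> 'a) measure)) < \<infinity>"
      using K by (simp add: nn_integral_multc nn_integral_gauss ennreal_mult_less_top)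
    show "AE s in nu. ennreal (gauss s) * D (inverse (real (Suc n)) *\<^sub>R s) \<le> ennreal (gauss s) * (4 * K)" for n
      by (intro AE_I2 mult_left_mono D4) auto
    have "(\<lambda>n. D (inverse (real (Suc n)) *\<^sub>R s)) \<longlonglongrightarrow> 0" for s
    proof -
      have "(\<lambda>n. inverse (real (Suc n)) *\<^sub>R (s, s)) \<longlonglongrightarrow> 0 *\<^sub>R (s, s)"
        by (intro tendsto_intros LIMSEQ_inverse_real_of_nat)
      then have "(\<lambda>n. inverse (real (Suc n)) *\<^sub>R (s, s)) \<longlonglongrightarrow> 0"
        unfolding scaleR_zero_left .
      from L2_translation_tendsto[OF _ _ this, of k] K kK show ?thesis
        by (simp add: D_def)
    qed
    then have "(\<lambda>n. ennreal (gauss s) * D (inverse (real (Suc n)) *\<^sub>R s)) \<longlonglongrightarrow> ennreal (gauss s) * 0" for s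
      by (intro ennreal_tendsto_cmult) auto
    then show "AE s in nu. (\<lambda>n. ennreal (gauss s) * D (inverse (real (Suc n)) *\<^sub>R s)) \<longlonglongrightarrow> 0"
      by simp
  qed auto
  show "(\<integral>\<^sup>+x. \<integral>\<^sup>+w. ennreal ((norm (qft (hprod f g x) w))\<^sup>2) \<partial>nu \<partial>nu) = K"
  proof (rule antisym)
    show "(\<integral>\<^sup>+x. \<integral>\<^sup>+w. ennreal ((norm (qft (hprod f g x) w))\<^sup>2) \<partial>nu \<partial>nu) \<le> K"
    proof (rule nn_integral_le_of_gauss_weighted)
      show "(\<integral>\<^sup>+x. \<integral>\<^sup>+w. ennreal (gauss (e *\<^sub>R w) * (norm (qft (hprod f g x) w))\<^sup>2) \<partial>nu \<partial>nu) \<le> K" if "0 < e" for e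
        unfolding I_def[symmetric] SK[symmetric] using that by (intro nn_integral_mono IS)
    qed (simp add: case_prod_beta)
    \<comment> \<open>The lower bound \<open>gauss_qft_bounds(2)\<close> is available where
      \<open>S x\<close> is finite. The weight is then dropped by \<open>gauss_le_1\<close>, and the
      error vanishes by \<open>R0\<close>.\<close>
    have AE: "AE x in nu. S x \<noteq> \<infinity>"
      using SK K by (intro nn_integral_PInf_AE) auto
    have "K \<le> (\<integral>\<^sup>+x. \<integral>\<^sup>+w. ennreal ((norm (qft (hprod f g x) w))\<^sup>2) \<partial>nu \<partial>nu) +
        (\<integral>\<^sup>+s. ennreal (gauss s) * D (inverse (real (Suc n)) *\<^sub>R s) \<partial>nu)" for n
    proof -
      define e where "e = inverse (real (Suc n))"
      have e: "0 < e"
        by (simp add: e_def)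
      have "K = (\<integral>\<^sup>+x. S x \<partial>nu)"
        by (simp add: SK)
      also have "\<dots> \<le> (\<integral>\<^sup>+x. I e x + Q e x \<partial>nu)"
        using AE by (intro nn_integral_mono_AE, eventually_elim)
          (auto simp: S_def I_def Q_def less_top intro!: gauss_qft_bounds(2) int e)
      also have "\<dots> = (\<integral>\<^sup>+x. I e x \<partial>nu) + (\<integral>\<^sup>+s. ennreal (gauss s) * D (e *\<^sub>R s) \<partial>nu)"
        by (simp add: nn_integral_add QD e)
      also have "(\<integral>\<^sup>+x. I e x \<partial>nu) \<le> (\<integral>\<^sup>+x. \<integral>\<^sup>+w. ennreal ((norm (qft (hprod f g x) w))\<^sup>2) \<partial>nu \<partial>nu)"
        unfolding I_def by (intro nn_integral_mono ennreal_leI mult_left_le_one_le gauss_le_1) auto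
      finally show ?thesis
        by (simp add: e_def add_right_mono)
    qed
    moreover have "(\<lambda>n. (\<integral>\<^sup>+x. \<integral>\<^sup>+w. ennreal ((norm (qft (hprod f g x) w))\<^sup>2) \<partial>nu \<partial>nu) +
        (\<integral>\<^sup>+s. ennreal (gauss s) * D (inverse (real (Suc n)) *\<^sub>R s) \<partial>nu)) \<longlonglongrightarrow>
        (\<integral>\<^sup>+x. \<integral>\<^sup>+w. ennreal ((norm (qft (hprod f g x) w))\<^sup>2) \<partial>nu \<partial>nu) + 0"
      using R0 by (intro tendsto_add tendsto_const) simp
    ultimately show "K \<le> (\<integral>\<^sup>+x. \<integral>\<^sup>+w. ennreal ((norm (qft (hprod f g x) w))\<^sup>2) \<partial>nu \<partial>nu)"
      by (intro LIMSEQ_le_const) auto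
  qed
qed

section \<open>The entropy of the ambiguity function\<close>

lemma nn_integral_mu:
  fixes f :: "'a::euclidean_space \<Rightarrow> ennreal"
  assumes [measurable]: "f \<in> borel_measurable borel"
  shows "(\<integral>\<^sup>+x. f x \<partial>mu) = (\<integral>\<^sup>+x. f x \<partial>nu)"
proof -
  have [measurable]: "f \<in> borel_measurable lebesgue"
    by (intro measurable_completion) simp
  show ?thesis
    by (simp add: mu_def nn_integral_density nn_integral_cmult nn_integral_completion nn_integral_nu)
qed

lemma integral_mu:
  fixes f :: "'a::euclidean_space \<Rightarrow> 'b :: {banach, second_countable_topology}"
  assumes [measurable]: "f \<in> borel_measurable borel"
  shows "(LINT x|mu. f x) = (LINT x|nu. f x)"
proof -
  have [measurable]: "f \<in> borel_measurable lebesgue"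
    by (intro measurable_completion) simp
  show ?thesis
    unfolding mu_def by (subst integral_density) (auto simp: integral_nu integral_completion)
qed

lemma AE_mu_iff: "(AE x in mu. P x) \<longleftrightarrow> (AE x in (lborel :: 'a::euclidean_space measure). P x)"
  unfolding mu_def by (subst AE_density) (auto simp: AE_completion_iff ennreal_eq_0_iff)

lemma AE_lborel_shift:
  fixes a :: "'a::euclidean_space"
  assumes "AE x in lborel. P x"
  shows "AE x in lborel. P (x + a)"
proof -
  have "distr lborel borel ((+) a) = (lborel :: 'a measure)"
    by (rule lborel_distr_plus)
  with assms have "AE x in distr lborel borel ((+) a). P x"
    by metis
  then have "AE x in lborel. P (a + x)"
    by (rule AE_distrD[rotated]) simp
  then show ?thesis
    by (simp add: add.commute)
qed

lemma lebesgue_measurable_shift: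
  fixes a :: "'a::euclidean_space"
  shows "(\<lambda>x. x + a) \<in> lebesgue \<rightarrow>\<^sub>M lebesgue"
  using lebesgue_affine_measurable[of "\<lambda>_. 1" a] by (simp add: euclidean_representation add.commute)

lemma lebesgue_measurable_borel_version:
  fixes f :: "'a::euclidean_space \<Rightarrow> 'b::euclidean_space"
  assumes "f \<in> borel_measurable lebesgue"
  obtains f' where "f' \<in> borel_measurable borel" "AE x in lborel. f x = f' x"
proof -
  have "\<exists>g \<in> borel_measurable lborel. AE x in lborel. f x \<bullet> b = g x" for b
    using assms by (intro completion_ex_borel_measurable_real) simp
  then obtain g where g: "\<And>b. g b \<in> borel_measurable lborel" "\<And>b. AE x in lborel. f x \<bullet> b = g b x"
    by metis
  have "AE x in lborel. \<forall>b\<in>Basis. f x \<bullet> b = g b x"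
    using g(2) by (intro AE_finite_allI) auto
  then have "AE x in lborel. f x = (\<Sum>b\<in>Basis. g b x *\<^sub>R b)"
  proof eventually_elim
    case (elim x)
    then have "(\<Sum>b\<in>Basis. g b x *\<^sub>R b) = (\<Sum>b\<in>Basis. (f x \<bullet> b) *\<^sub>R b)"
      by (intro sum.cong) auto
    then show ?case
      by (simp add: euclidean_representation)
  qed
  moreover have "(\<lambda>x. \<Sum>b\<in>Basis. g b x *\<^sub>R b) \<in> borel_measurable borel"
    using g(1) by (intro borel_measurable_sum borel_measurable_scaleR) auto
  ultimately show ?thesis
    by (intro that)
qed

text \<open>Translations preserve null sets, so for every single \<open>x\<close> and
  \<open>w\<close> the integrands agree almost everywhere; the ambiguity functions agree at every
  point.\<close>

lemma ambiguity_cong_AE: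
  fixes f g f' g' :: "(real^'d) \<times> (real^'d) \<Rightarrow> quat"
  assumes f: "f \<in> borel_measurable lebesgue" "f' \<in> borel_measurable lebesgue" "AE t in lborel. f t = f' t"
    and g: "g \<in> borel_measurable lebesgue" "g' \<in> borel_measurable lebesgue" "AE t in lborel. g t = g' t"
  shows "ambiguity f g = ambiguity f' g'"
proof (intro ext)
  fix x w :: "(real^'d) \<times> (real^'d)"
  have M: "(\<lambda>t. exp (- ((fst t \<bullet> fst w) *\<^sub>R quat_i)) * u (t + (1/2) *\<^sub>R x) * qcnj (v (t - (1/2) *\<^sub>R x)) *
       exp (- ((snd t \<bullet> snd w) *\<^sub>R quat_j))) \<in> borel_measurable mu"
    if [measurable]: "u \<in> borel_measurable lebesgue" "v \<in> borel_measurable lebesgue" for u v :: "(real^'d) \<times> (real^'d) \<Rightarrow> quat"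
  proof -
    have [measurable]: "(\<lambda>t. u (t + a)) \<in> borel_measurable lebesgue" "(\<lambda>t. v (t + a)) \<in> borel_measurable lebesgue" for a
      using measurable_compose[OF lebesgue_measurable_shift[of a] that(1)]
        measurable_compose[OF lebesgue_measurable_shift[of a] that(2)] by auto
    have [measurable]: "(\<lambda>t::(real^'d) \<times> (real^'d). fst t \<bullet> fst w) \<in> borel_measurable lebesgue"
      "(\<lambda>t::(real^'d) \<times> (real^'d). snd t \<bullet> snd w) \<in> borel_measurable lebesgue"
      by (intro measurable_completion; simp)+
    \<comment> \<open>The exponentials are written as rotations of 1, whose measurability is
      known.\<close>
    have "(\<lambda>t. left.rot (fst t \<bullet> fst w) 1 * u (t + (1/2) *\<^sub>R x) * qcnj (v (t + - (1/2) *\<^sub>R x)) *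
        right.rot (snd t \<bullet> snd w) 1) \<in> borel_measurable lebesgue"
      by measurable
    then show ?thesis
      by (simp add: mu_def left_rot_eq right_rot_eq)
  qed
  have "AE t in lborel. f (t + (1/2) *\<^sub>R x) = f' (t + (1/2) *\<^sub>R x)"
    "AE t in lborel. g (t + (- (1/2) *\<^sub>R x)) = g' (t + (- (1/2) *\<^sub>R x))"
    using AE_lborel_shift[OF f(3)] AE_lborel_shift[OF g(3)] .
  then have "AE t in lborel. f (t + (1/2) *\<^sub>R x) = f' (t + (1/2) *\<^sub>R x) \<and>
      g (t - (1/2) *\<^sub>R x) = g' (t - (1/2) *\<^sub>R x)"
    by eventually_elim simp
  then show "ambiguity f g x w = ambiguity f' g' x w"
    unfolding ambiguity_def
    by (intro integral_cong_AE M f g, unfold AE_mu_iff) (erule eventually_mono, simp)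
qed

section \<open>The ambiguity function as a quaternion Fourier transform\<close>

lemma (in complex_structure) rot_add: "rot (b + c) p = rot b (rot c p)"
proof -
  have "J (rot c p) = cos c *\<^sub>R J p + sin c *\<^sub>R p"
    by (simp add: rot_def linear_diff[OF linear_J] linear_scale[OF linear_J] JJ)
  then show ?thesis
    by (simp add: rot_def cos_add sin_add algebra_simps)
qed

lemma qrot_diff: "qrot w (t - c) p = left.rot (- (fst c \<bullet> fst w)) (right.rot (- (snd c \<bullet> snd w)) (qrot w t p))"
proof -
  have comm: "right.rot a (left.rot b p) = left.rot b (right.rot a p)" for a b p
    by (simp add: left_rot_eq right_rot_eq mult.assoc)
  show ?thesis
    unfolding qrot_def comm left.rot_add[symmetric] right.rot_add[symmetric]
    by (simp add: inner_diff_left)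
qed

text \<open>The substitution turns the integrand into that of \<open>qft\<close> up to rotations by
  angles independent of \<open>t\<close>. These leave the integral and preserve the norm.\<close>

lemma norm_ambiguity:
  fixes f g :: "(real^'d) \<times> (real^'d) \<Rightarrow> quat"
  assumes [measurable]: "f \<in> borel_measurable borel" "g \<in> borel_measurable borel"
    and int: "integrable nu (hprod f g x)"
  shows "norm (ambiguity f g x w) = norm (qft (hprod f g x) w)"
proof -
  have "ambiguity f g x w = (LINT t|mu. qrot w t (hprod f g x ((1/2) *\<^sub>R x + 1 *\<^sub>R t)))"
  proof -
    have eq: "(1/2) *\<^sub>R x + 1 *\<^sub>R t - x = t - (1/2) *\<^sub>R x" for t
      by (simp add: prod_eq_iff vec_eq_iff)
    have "hprod f g x ((1/2) *\<^sub>R x + 1 *\<^sub>R t) = f (t + (1/2) *\<^sub>R x) * qcnj (g (t - (1/2) *\<^sub>R x))" for t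
      unfolding hprod_def eq by (simp add: add.commute)
    then show ?thesis
      by (simp only: ambiguity_def qrot_def left_rot_eq right_rot_eq mult.assoc)
  qed
  also have "\<dots> = (LINT t|nu. qrot w t (hprod f g x ((1/2) *\<^sub>R x + 1 *\<^sub>R t)))"
    by (rule integral_mu) simp
  also have "\<dots> = (LINT t|nu. qrot w (((1/2) *\<^sub>R x + 1 *\<^sub>R t) - (1/2) *\<^sub>R x) (hprod f g x ((1/2) *\<^sub>R x + 1 *\<^sub>R t)))"
    by simp
  also have "\<dots> = (LINT t|nu. qrot w (t - (1/2) *\<^sub>R x) (hprod f g x t))"
    by (subst integral_nu_affine) auto
  also have "\<dots> = left.rot (- (fst ((1/2) *\<^sub>R x) \<bullet> fst w)) (right.rot (- (snd ((1/2) *\<^sub>R x) \<bullet> snd w)) (qft (hprod f g x) w))"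
  proof -
    have I: "integrable nu (\<lambda>t. qrot w t (hprod f g x t))"
      by (rule integrable_qrot[OF int])
    then have "integrable nu (\<lambda>t. right.rot a (qrot w t (hprod f g x t)))" for a
      by (simp add: integrable_iff_bounded)
    then show ?thesis
      by (simp only: qrot_diff left.integral_rot right.integral_rot[OF I] qft_eq_integral[OF int])
  qed
  finally show ?thesis
    by simp
qed

text \<open>Jensen's inequality through a tangent of the logarithm:
  \<open>ln P \<le> ln c + P / c - 1\<close> is multiplied by \<open>P\<close> and integrated, and
  the last two terms contribute at most \<open>N - N\<close>.\<close>

lemma entropy_lower_bound:
  fixes P :: "'a::euclidean_space \<Rightarrow> real"
  assumes [measurable]: "P \<in> borel_measurable borel" and P: "\<And>z. 0 \<le> P z"
    and N: "(\<integral>\<^sup>+z. ennreal (P z) \<partial>nu) = ennreal N" "0 < N"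
    and c: "(\<integral>\<^sup>+z. ennreal ((P z)\<^sup>2) \<partial>nu) \<le> ennreal (c * N)" "0 < c"
  shows "ereal (- (N * ln c)) \<le> entropy P"
proof -
  have IP: "integrable nu P" "(LINT z|nu. P z) = N"
    using N P by (auto simp: integrable_iff_bounded integral_eq_nn_integral)
  have "(\<integral>\<^sup>+z. ennreal ((P z)\<^sup>2) \<partial>nu) < \<infinity>"
    using c(1) by (rule order.strict_trans1) simp
  then have IP2: "integrable nu (\<lambda>z. (P z)\<^sup>2)"
    by (simp add: integrable_iff_bounded)
  then have "ennreal (LINT z|nu. (P z)\<^sup>2) \<le> ennreal (c * N)"
    using c(1) by (simp add: nn_integral_eq_integral)
  then have P2: "(LINT z|nu. (P z)\<^sup>2) \<le> c * N"
    using c N by simp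
  \<comment> \<open>Used for the given \<open>c\<close> in the estimate and for 1 in the finiteness
    argument. Where \<open>P z = 0\<close> both sides are 0.\<close>
  have le: "ln (P z) * P z \<le> ln c * P z + (P z)\<^sup>2 / c - P z" if "0 < c" for z c
  proof (cases "P z = 0")
    case False
    then have "0 < P z"
      using P[of z] by simp
    then have "ln (P z / c) \<le> P z / c - 1"
      using that by (intro ln_le_minus_one) auto
    then have "ln (P z) \<le> ln c + P z / c - 1"
      using \<open>0 < P z\<close> that by (simp add: ln_div)
    from mult_right_mono[OF this P[of z]] show ?thesis
      by (simp add: algebra_simps power2_eq_square)
  qed simp
  \<comment> \<open>The positive part of \<open>P ln P\<close> has finite integral, so the
    difference in \<open>entropy\<close> is not indeterminate.\<close>
  have "ln (P z) * P z \<le> (P z)\<^sup>2" for z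
    using le[of 1 z] P[of z] by simp
  then have "(\<integral>\<^sup>+z. ennreal (ln (P z) * P z) \<partial>nu) \<le> (\<integral>\<^sup>+z. ennreal ((P z)\<^sup>2) \<partial>nu)"
    by (intro nn_integral_mono ennreal_leI)
  then have A: "(\<integral>\<^sup>+z. ennreal (ln (P z) * P z) \<partial>nu) < \<infinity>"
    using \<open>(\<integral>\<^sup>+z. ennreal ((P z)\<^sup>2) \<partial>nu) < \<infinity>\<close> by (rule order.strict_trans1)
  have entropy_nu: "entropy P = - (enn2ereal (\<integral>\<^sup>+z. ennreal (ln (P z) * P z) \<partial>nu) -
       enn2ereal (\<integral>\<^sup>+z. ennreal (- (ln (P z) * P z)) \<partial>nu))"
    unfolding entropy_def by (subst (1 2) nn_integral_mu) auto
  obtain a where a: "(\<integral>\<^sup>+z. ennreal (ln (P z) * P z) \<partial>nu) = ennreal a" "0 \<le> a"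
    using A by (cases "\<integral>\<^sup>+z. ennreal (ln (P z) * P z) \<partial>nu") auto
  show ?thesis
  proof (cases "\<integral>\<^sup>+z. ennreal (- (ln (P z) * P z)) \<partial>nu")
    \<comment> \<open>Here the entropy is \<infinity>.\<close>
    case top
    then show ?thesis
      unfolding entropy_nu by (simp add: a)
  next
    case (real b)
    have I: "integrable nu (\<lambda>z. ln (P z) * P z)"
      using a real by (simp add: real_integrable_def)
    then have "(LINT z|nu. ln (P z) * P z) = a - b"
      using a real by (simp add: real_lebesgue_integral_def)
    moreover have "(LINT z|nu. ln (P z) * P z) \<le> (LINT z|nu. ln c * P z + (P z)\<^sup>2 / c - P z)"
      using I IP IP2 le c(2) by (intro integral_mono) auto
    moreover have "(LINT z|nu. ln c * P z + (P z)\<^sup>2 / c - P z) = ln c * N + (LINT z|nu. (P z)\<^sup>2) / c - N"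
      using IP IP2 by simp
    moreover have "(LINT z|nu. (P z)\<^sup>2) / c \<le> N"
      using P2 c by (simp add: field_simps)
    ultimately have "a - b \<le> N * ln c"
      by (simp add: mult.commute)
    then show ?thesis
      unfolding entropy_nu a real(2) using a(2) real(1) by simp
  qed
qed

lemma square_integrable_borel_version:
  fixes f :: "'a::euclidean_space \<Rightarrow> quat"
  assumes f: "square_integrable f" and nz: "\<not> (AE t in mu. f t = 0)"
  obtains f' where "f' \<in> borel_measurable borel" "AE t in lborel. f t = f' t"
    "(\<integral>\<^sup>+t. ennreal ((norm (f' t))\<^sup>2) \<partial>nu) = ennreal ((L2_norm f)\<^sup>2)" "0 < (L2_norm f)\<^sup>2"
proof -
  have "f \<in> borel_measurable lebesgue" and int: "integrable mu (\<lambda>t. (norm (f t))\<^sup>2)"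
    using f by (auto simp: square_integrable_def mu_def)
  then obtain f' where f' [measurable]: "f' \<in> borel_measurable borel" and ae: "AE t in lborel. f t = f' t"
    using lebesgue_measurable_borel_version by blast
  have L2: "(L2_norm f)\<^sup>2 = (LINT t|mu. (norm (f t))\<^sup>2)"
    unfolding L2_norm_def by (simp add: integral_nonneg)
  have "(\<integral>\<^sup>+t. ennreal ((norm (f' t))\<^sup>2) \<partial>nu) = (\<integral>\<^sup>+t. ennreal ((norm (f' t))\<^sup>2) \<partial>mu)"
    by (rule nn_integral_mu[symmetric]) simp
  also have "\<dots> = (\<integral>\<^sup>+t. ennreal ((norm (f t))\<^sup>2) \<partial>mu)"
    using ae by (intro nn_integral_cong_AE, unfold AE_mu_iff) (erule eventually_mono, simp)
  also have "\<dots> = ennreal ((L2_norm f)\<^sup>2)"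
    unfolding L2 using int by (intro nn_integral_eq_integral) auto
  finally have "(\<integral>\<^sup>+t. ennreal ((norm (f' t))\<^sup>2) \<partial>nu) = ennreal ((L2_norm f)\<^sup>2)" .
  moreover have "(L2_norm f)\<^sup>2 \<noteq> 0"
    using nz integral_nonneg_eq_0_iff_AE[OF int] unfolding L2 by simp
  ultimately show ?thesis
    using f' ae by (intro that) auto
qed

theorem corollary9:
  fixes f g :: "(real^'d) \<times> (real^'d) \<Rightarrow> quat"
  assumes "square_integrable f" and "square_integrable g"
    and "\<not> (AE t in mu. f t = 0)" and "\<not> (AE t in mu. g t = 0)"
  shows "entropy (\<lambda>(x, w). (norm (ambiguity f g x w))\<^sup>2) \<ge>
    ereal ((L2_norm f)\<^sup>2 * (L2_norm g)\<^sup>2 *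
      (2 * real CARD('d) * ln 2 - ln ((L2_norm f)\<^sup>2 * (L2_norm g)\<^sup>2)))"
proof -
  obtain f' where f' [measurable]: "f' \<in> borel_measurable borel" and f_ae: "AE t in lborel. f t = f' t"
    and f2: "(\<integral>\<^sup>+t. ennreal ((norm (f' t))\<^sup>2) \<partial>nu) = ennreal ((L2_norm f)\<^sup>2)" "0 < (L2_norm f)\<^sup>2"
    using square_integrable_borel_version[OF assms(1,3)] .
  obtain g' where g' [measurable]: "g' \<in> borel_measurable borel" and g_ae: "AE t in lborel. g t = g' t"
    and g2: "(\<integral>\<^sup>+t. ennreal ((norm (g' t))\<^sup>2) \<partial>nu) = ennreal ((L2_norm g)\<^sup>2)" "0 < (L2_norm g)\<^sup>2"
    using square_integrable_borel_version[OF assms(2,4)] .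
  define N where "N = (L2_norm f)\<^sup>2 * (L2_norm g)\<^sup>2"
  \<comment> \<open>The fourth power bound is \<open>N^2 / 4^d = c * N\<close>, so
    \<open>- ln c\<close> is the bracket of the claim.\<close>
  define c where "c = N / 2 ^ (2 * CARD('d))"
  define P where "P z = (norm (qft (hprod f' g' (fst z)) (snd z)))\<^sup>2" for z
  have N: "0 < N" "0 < c"
    using f2 g2 by (auto simp: N_def c_def)
  have [measurable]: "P \<in> borel_measurable borel"
    unfolding P_def by measurable
  have int: "integrable nu (hprod f' g' x)" for x
    by (rule qft_hprod_plancherel) (auto simp: f2 g2)
  have meas: "f \<in> borel_measurable lebesgue" "g \<in> borel_measurable lebesgue"
    using assms(1,2) by (auto simp: square_integrable_def mu_def)
  have "ambiguity f g = ambiguity f' g'"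
    by (intro ambiguity_cong_AE meas f_ae g_ae measurable_completion) simp_all
  then have P_eq: "(\<lambda>(x, w). (norm (ambiguity f g x w))\<^sup>2) = P"
    by (auto simp: P_def norm_ambiguity[OF f' g' int])
  have P1: "(\<integral>\<^sup>+z. ennreal (P z) \<partial>nu) = ennreal N"
  proof -
    have "(\<integral>\<^sup>+z. ennreal (P z) \<partial>nu) = ennreal ((L2_norm f)\<^sup>2) * ennreal ((L2_norm g)\<^sup>2)"
      using qft_hprod_plancherel(2)[OF f' g'] by (simp add: nn_integral_nu_pair P_def f2 g2)
    then show ?thesis
      by (simp add: N_def ennreal_mult)
  qed
  have P2: "(\<integral>\<^sup>+z. ennreal ((P z)\<^sup>2) \<partial>nu) \<le> ennreal (c * N)"
  proof -
    have "(\<integral>\<^sup>+x. \<integral>\<^sup>+w. ennreal (norm (qft (hprod f' g' x) w) ^ 4) \<partial>nu \<partial>nu) \<le>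
      ennreal (1 / 2 ^ (2 * DIM(real^'d))) *
      ((\<integral>\<^sup>+t. ennreal (norm (f' t)) ^ 2 \<partial>nu) * (\<integral>\<^sup>+t. ennreal (norm (g' t)) ^ 2 \<partial>nu))\<^sup>2"
    \<comment> \<open>The weighted fourth power bound is uniform in \<open>e\<close>, so the weight
      can be removed.\<close>
    proof (rule nn_integral_le_of_gauss_weighted)
      show "(\<lambda>(x, w). norm (qft (hprod f' g' x) w) ^ 4) \<in> borel_measurable borel"
        by (simp add: case_prod_beta)
    qed (rule qft_hprod_fourth_power_bound[OF f' g'])
    also have "\<dots> = ennreal (1 / 2 ^ (2 * CARD('d))) * (ennreal N)\<^sup>2"
      by (simp add: ennreal_power f2 g2 N_def ennreal_mult)
    also have "\<dots> = ennreal (c * N)"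
      using N by (simp add: c_def ennreal_power ennreal_mult[symmetric] power2_eq_square)
    finally show ?thesis
      by (simp add: nn_integral_nu_pair P_def power_mult[symmetric])
  qed
  have "ereal (- (N * ln c)) \<le> entropy P"
    by (rule entropy_lower_bound[OF _ _ P1 N(1) P2 N(2)]) (auto simp: P_def)
  moreover have "- (N * ln c) = N * (2 * real CARD('d) * ln 2 - ln N)"
    using N by (simp add: c_def ln_div ln_realpow algebra_simps)
  ultimately show ?thesis
    unfolding P_eq by (simp add: N_def)
qed

end
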